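(* Let $\mathcal{H}$ be a complex separable Hilbert space, let $p \geq 1$, and let $A, B$ be bounded linear operators on $\mathcal{H}$ with $B-A \in \mathcal{S}_p$. Then $$\sum_{\lambda \in \sigma_d(B)} \operatorname{dist}(\lambda, \overline{\operatorname{Num}}(A))^p \leq \|B-A\|_{\mathcal{S}_p}^p,$$ where each eigenvalue is counted according to its algebraic multiplicity.
   Context: $\operatorname{Num}(A)=\{\langle Af,f\rangle : f\in\mathcal{H}, \|f\|=1\}$ is the numerical range of $A$, and $\overline{\operatorname{Num}}(A)$ is its closure in $\mathbb{C}$. $\sigma_d(B)$ is the set of discrete eigenvalues of $B$, i.e. the isolated points of the spectrum that are eigenvalues of finite algebraic multiplicity. A compact operator $K$ on $\mathcal{H}$ belongs to the von Neumann-Schatten class $\mathcal{S}_p$ ($p>0$) if $\|K\|_{\mathcal{S}_p} := \left(\sum_n s_n(K)^p\right)^{1/p}<\infty$, where $s_1(K)\ge s_2(K)\ge\dots$ are the non-zero eigenvalues of $|K|=(K^*K)^{1/2}$, counted according to multiplicity. *)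

theory Defs
  imports "HOL-Analysis.Analysis"
begin

section \<open>Complex Hilbert spaces\<close>

class complex_vector = real_vector +
  fixes scaleC :: "complex \<Rightarrow> 'a \<Rightarrow> 'a"  (infixr \<open>*\<^sub>C\<close> 75)
  assumes scaleC_add_right: "a *\<^sub>C (x + y) = a *\<^sub>C x + a *\<^sub>C y"
    and scaleC_add_left: "(a + b) *\<^sub>C x = a *\<^sub>C x + b *\<^sub>C x"
    and scaleC_scaleC: "a *\<^sub>C (b *\<^sub>C x) = (a * b) *\<^sub>C x"
    and scaleR_scaleC: "r *\<^sub>R x = complex_of_real r *\<^sub>C x"

text \<open>The inner product is linear in its first argument.  Positive definiteness is part of
  \<open>cinner_self\<close>.\<close>

class complex_inner = complex_vector + real_normed_vector +
  fixes cinner :: "'a \<Rightarrow> 'a \<Rightarrow> complex"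
  assumes cinner_commute: "cinner x y = cnj (cinner y x)"
    and cinner_add_left: "cinner (x + y) z = cinner x z + cinner y z"
    and cinner_scaleC_left: "cinner (c *\<^sub>C x) y = c * cinner x y"
    and cinner_self: "cinner x x = complex_of_real ((norm x)\<^sup>2)"

class chilbert_space = complex_inner + complete_space

global_interpretation complex_vector: vector_space "scaleC :: complex \<Rightarrow> 'a \<Rightarrow> 'a::complex_vector"
proof unfold_locales
  show "1 *\<^sub>C x = x" for x :: 'a
    using scaleR_scaleC[of 1 x] by simp
qed (simp_all add: scaleC_add_right scaleC_add_left scaleC_scaleC)

text \<open>\<open>complex_vector.dim\<close> is \<open>0\<close> on infinite-dimensional sets, so finiteness of a dimension has to
  be required separately.\<close>

definition cfinite_dim :: "'a::complex_vector set \<Rightarrow> bool" where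
  "cfinite_dim V \<longleftrightarrow> (\<exists>S. finite S \<and> V \<subseteq> complex_vector.span S)"


section \<open>Bounded operators, spectrum and discrete eigenvalues\<close>

definition bounded_clinear :: "('a::complex_inner \<Rightarrow> 'a) \<Rightarrow> bool" where
  "bounded_clinear T \<longleftrightarrow> bounded_linear T \<and> (\<forall>c x. T (c *\<^sub>C x) = c *\<^sub>C T x)"

definition numerical_range :: "('a::complex_inner \<Rightarrow> 'a) \<Rightarrow> complex set" where
  "numerical_range A = {cinner (A f) f | f. norm f = 1}"

definition spectrum :: "('a::complex_inner \<Rightarrow> 'a) \<Rightarrow> complex set" where
  "spectrum B = {z. \<not> (\<exists>R. bounded_clinear R \<and>
      (\<forall>x. R (B x - z *\<^sub>C x) = x) \<and> (\<forall>x. B (R x) - z *\<^sub>C R x = x))}"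

definition eigenspace :: "('a::complex_inner \<Rightarrow> 'a) \<Rightarrow> complex \<Rightarrow> 'a set" where
  "eigenspace B z = {x. B x = z *\<^sub>C x}"

definition eigenvalue :: "('a::complex_inner \<Rightarrow> 'a) \<Rightarrow> complex \<Rightarrow> bool" where
  "eigenvalue B z \<longleftrightarrow> (\<exists>x \<in> eigenspace B z. x \<noteq> 0)"

text \<open>The algebraic multiplicity of an eigenvalue is the dimension of its root space.\<close>

definition root_space :: "('a::complex_inner \<Rightarrow> 'a) \<Rightarrow> complex \<Rightarrow> 'a set" where
  "root_space B z = {x. \<exists>k. ((\<lambda>y. B y - z *\<^sub>C y) ^^ k) x = 0}"

definition alg_mult :: "('a::complex_inner \<Rightarrow> 'a) \<Rightarrow> complex \<Rightarrow> nat" where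
  "alg_mult B z = complex_vector.dim (root_space B z)"

definition discrete_spectrum :: "('a::complex_inner \<Rightarrow> 'a) \<Rightarrow> complex set" where
  "discrete_spectrum B =
    {z. z isolated_in spectrum B \<and> eigenvalue B z \<and> cfinite_dim (root_space B z)}"


section \<open>Schatten classes\<close>

definition compact_operator :: "('a::complex_inner \<Rightarrow> 'a) \<Rightarrow> bool" where
  "compact_operator K \<longleftrightarrow> bounded_clinear K \<and> compact (closure (K ` cball 0 1))"

definition adjoint_op :: "('a::chilbert_space \<Rightarrow> 'a) \<Rightarrow> ('a \<Rightarrow> 'a)" where
  "adjoint_op K = (THE T. bounded_clinear T \<and> (\<forall>x y. cinner (K x) y = cinner x (T y)))"

definition positive_op :: "('a::complex_inner \<Rightarrow> 'a) \<Rightarrow> bool" where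
  "positive_op P \<longleftrightarrow> bounded_clinear P \<and> (\<forall>x. cinner (P x) x \<in> \<real>\<^sub>\<ge>\<^sub>0)"

text \<open>\<open>\<bar>K\<bar> = (K\<^sup>*K)\<^bsup>1/2\<^esup>\<close>, the unique positive square root of \<open>K\<^sup>*K\<close>.\<close>

definition modulus_op :: "('a::chilbert_space \<Rightarrow> 'a) \<Rightarrow> ('a \<Rightarrow> 'a)" where
  "modulus_op K = (THE P. positive_op P \<and> P \<circ> P = adjoint_op K \<circ> K)"

definition modulus_eigenvalues :: "('a::chilbert_space \<Rightarrow> 'a) \<Rightarrow> real set" where
  "modulus_eigenvalues K = {t. t > 0 \<and> eigenvalue (modulus_op K) (complex_of_real t)}"

definition modulus_mult :: "('a::chilbert_space \<Rightarrow> 'a) \<Rightarrow> real \<Rightarrow> nat" where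
  "modulus_mult K t = complex_vector.dim (eigenspace (modulus_op K) (complex_of_real t))"

text \<open>For compact \<open>K\<close>, the non-zero eigenvalues of \<open>\<bar>K\<bar>\<close> in decreasing order, repeated according to
  multiplicity, are \<open>singular_value K 0 \<ge> singular_value K 1 \<ge> \<dots>\<close> (indexing from 0).  The \<open>n\<close>-th
  one is the largest eigenvalue \<open>t\<close> such that more than \<open>n\<close> eigenvalues, counted with multiplicity,
  are \<open>\<ge> t\<close>.  If there are at most \<open>n\<close> in total, the value is \<open>0\<close>.\<close>

definition singular_value :: "('a::chilbert_space \<Rightarrow> 'a) \<Rightarrow> nat \<Rightarrow> real" where
  "singular_value K n = Sup (insert 0 {t \<in> modulus_eigenvalues K.
      n < (\<Sum>u \<in> {u \<in> modulus_eigenvalues K. t \<le> u}. modulus_mult K u)})"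

definition schatten_class :: "real \<Rightarrow> ('a::chilbert_space \<Rightarrow> 'a) set" where
  "schatten_class p = {K. compact_operator K \<and> summable (\<lambda>n. singular_value K n powr p)}"

definition schatten_norm :: "real \<Rightarrow> ('a::chilbert_space \<Rightarrow> 'a) \<Rightarrow> real" where
  "schatten_norm p K = (\<Sum>n. singular_value K n powr p) powr (1 / p)"

end

theory Submission
  imports Defs
begin

text \<open>Let \<open>K = B - A\<close>.  For finitely many discrete eigenvalues of \<open>B\<close>, a Schur basis \<open>e\<^sub>0, e\<^sub>1, \<dots>\<close> of
  an invariant subspace containing their root spaces satisfies \<open>\<langle>B e\<^sub>i, e\<^sub>i\<rangle> = \<lambda>\<^sub>i\<close>, with every eigenvalue
  occurring at least as often as its algebraic multiplicity.  Since \<open>\<langle>A e\<^sub>i, e\<^sub>i\<rangle>\<close> lies in the numerical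
  range, the distance of \<open>\<lambda>\<^sub>i\<close> to it is at most \<open>\<bar>\<langle>K e\<^sub>i, e\<^sub>i\<rangle>\<bar>\<close>.  Expanding \<open>K\<close> in a singular value
  decomposition, Jensen's and Bessel's inequalities give
  \<open>\<Sum>\<^sub>i \<bar>\<langle>K e\<^sub>i, e\<^sub>i\<rangle>\<bar>\<^sup>p \<le> \<Sum>\<^sub>n s\<^sub>n(K)\<^sup>p\<close> for every orthonormal family.\<close>

section \<open>Inner product spaces\<close>

text \<open>Schur triangularization is a finite-dimensional device, while the discrete spectrum may
  be infinite. The estimate is therefore proved for finite sets of eigenvalues with a bound
  independent of the set, which yields summability and the inequality together. Surplus diagonal
  entries only add nonnegative terms, so one-sided comparisons of multiplicities suffice. On the
  side of \<open>K\<close> the obstacle lies in the definitions: adjoint and modulus are definite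
  descriptions, and singular values are read off from dimensions of eigenspaces of the modulus. The
  link is an orthonormal set \<open>E\<close> of eigenvectors of
  \<open>adjoint_op K \<circ> K\<close>, maximal by Zorn's lemma. The modulus is diagonal on
  \<open>E\<close> with entries \<open>norm (K e)\<close>, so dimensions become cardinalities of
  subsets of \<open>E\<close>. No decreasing enumeration of \<open>E\<close> is formed; finite
  subsets of \<open>E\<close> are compared with the leading singular values. The exponent
  \<open>p \<ge> 1\<close> acts twice: through convexity, and through
  \<open>W powr p \<le> W\<close> for a total weight \<open>W \<le> 1\<close>.\<close>

lemma cinner_add_right: "cinner x (y + z) = cinner x y + cinner x (z::'a::complex_inner)"
  by (metis cinner_add_left cinner_commute complex_cnj_add)

lemma cinner_scaleC_right: "cinner x (c *\<^sub>C y) = cnj c * cinner x (y::'a::complex_inner)"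
  by (metis cinner_commute cinner_scaleC_left complex_cnj_mult)

lemma cinner_zero_left [simp]: "cinner 0 (y::'a::complex_inner) = 0"
  using cinner_add_left[of 0 0 y] by simp

lemma cinner_zero_right [simp]: "cinner (y::'a::complex_inner) 0 = 0"
  using cinner_add_right[of y 0 0] by simp

lemma cinner_minus_left: "cinner (- x) y = - cinner x (y::'a::complex_inner)"
  using cinner_add_left[of x "- x" y] by (simp add: add_eq_0_iff)

lemma cinner_minus_right: "cinner x (- y) = - cinner x (y::'a::complex_inner)"
  using cinner_add_right[of x y "- y"] by (simp add: add_eq_0_iff)

lemma cinner_diff_left: "cinner (x - y) z = cinner x z - cinner y (z::'a::complex_inner)"
  using cinner_add_left[of x "- y" z] by (simp add: cinner_minus_left)

lemma cinner_diff_right: "cinner x (y - z) = cinner x y - cinner x (z::'a::complex_inner)"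
  using cinner_add_right[of x y "- z"] by (simp add: cinner_minus_right)

lemmas cinner_simps = cinner_add_left cinner_add_right cinner_diff_left cinner_diff_right
  cinner_minus_left cinner_minus_right cinner_scaleC_left cinner_scaleC_right

lemma cinner_scaleR_left: "cinner (r *\<^sub>R x) y = of_real r * cinner x (y::'a::complex_inner)"
  by (simp add: scaleR_scaleC cinner_scaleC_left)

lemma cinner_scaleR_right: "cinner x (r *\<^sub>R y) = of_real r * cinner x (y::'a::complex_inner)"
  by (simp add: scaleR_scaleC cinner_scaleC_right)

lemma cinner_sum_left: "cinner (sum f S) y = (\<Sum>i\<in>S. cinner (f i) (y::'a::complex_inner))"
  by (induction S rule: infinite_finite_induct) (simp_all add: cinner_add_left)

lemma cinner_sum_right: "cinner y (sum f S) = (\<Sum>i\<in>S. cinner (y::'a::complex_inner) (f i))"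
  by (induction S rule: infinite_finite_induct) (simp_all add: cinner_add_right)

lemma cinner_eq_zero_commute: "cinner x y = 0 \<longleftrightarrow> cinner y (x::'a::complex_inner) = 0"
  by (metis cinner_commute complex_cnj_zero)

lemma cmod_cinner_commute: "cmod (cinner x y) = cmod (cinner y (x::'a::complex_inner))"
  by (metis cinner_commute complex_mod_cnj)

lemma Re_cinner_self: "Re (cinner x x) = (norm (x::'a::complex_inner))\<^sup>2"
  by (simp add: cinner_self)

lemma cinner_self_eq_0 [simp]: "cinner x x = 0 \<longleftrightarrow> x = (0::'a::complex_inner)"
  by (simp add: cinner_self)

text \<open>The normed-space axioms speak of real scalars only; homogeneity for complex ones is read
  off from \<open>cinner_self\<close>.\<close>

lemma norm_scaleC: "norm (c *\<^sub>C x) = cmod c * norm (x::'a::complex_inner)"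
proof -
  have "cinner (c *\<^sub>C x) (c *\<^sub>C x) = (c * cnj c) * cinner x x"
    by (simp add: cinner_simps)
  also have "\<dots> = complex_of_real ((cmod c * norm x)\<^sup>2)"
    unfolding complex_norm_square[symmetric]
    by (simp add: cinner_self power_mult_distrib)
  finally have "(norm (c *\<^sub>C x))\<^sup>2 = (cmod c * norm x)\<^sup>2"
    by (simp only: cinner_self of_real_eq_iff)
  then show ?thesis
    by (simp add: power2_eq_iff_nonneg)
qed

lemma cauchy_schwarz: "cmod (cinner x y) \<le> norm x * norm (y::'a::complex_inner)"
proof (cases "y = 0")
  case False
  define c where "c = cinner x y / of_real ((norm y)\<^sup>2)"
  have c: "c * of_real ((norm y)\<^sup>2) = cinner x y"
    using False by (simp add: c_def)
  have "cinner (x - c *\<^sub>C y) (x - c *\<^sub>C y)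
      = cinner x x - c * cinner y x - cnj c * (cinner x y - c * cinner y y)"
    by (simp add: cinner_simps algebra_simps)
  also have "\<dots> = cinner x x - c * cnj (cinner x y)"
    using c by (simp add: cinner_self cinner_commute[of y x])
  also have "c * cnj (cinner x y) = of_real ((cmod (cinner x y))\<^sup>2 / (norm y)\<^sup>2)"
    by (simp add: c_def complex_norm_square[symmetric] del: complex_cnj_divide)
  finally have "complex_of_real ((norm (x - c *\<^sub>C y))\<^sup>2)
      = of_real ((norm x)\<^sup>2 - (cmod (cinner x y))\<^sup>2 / (norm y)\<^sup>2)"
    by (simp only: cinner_self of_real_diff)
  then have "(norm (x - c *\<^sub>C y))\<^sup>2 = (norm x)\<^sup>2 - (cmod (cinner x y))\<^sup>2 / (norm y)\<^sup>2"
    by (simp only: of_real_eq_iff)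
  then have "(cmod (cinner x y))\<^sup>2 / (norm y)\<^sup>2 \<le> (norm x)\<^sup>2"
    by (metis diff_ge_0_iff_ge zero_le_power2)
  then have "(cmod (cinner x y))\<^sup>2 \<le> (norm x * norm y)\<^sup>2"
    using False by (simp add: field_simps power_mult_distrib)
  then show ?thesis
    by (simp add: power2_le_iff_abs_le)
qed simp

lemma bounded_linear_cinner_left: "bounded_linear (\<lambda>x. cinner x (y::'a::complex_inner))"
  by (rule bounded_linear_intro[where K = "norm y"])
    (auto simp: cinner_add_left cinner_scaleR_left scaleR_conv_of_real cauchy_schwarz)

lemma bounded_linear_scaleC: "bounded_linear (\<lambda>x::'a::complex_inner. c *\<^sub>C x)"
  by (rule bounded_linear_intro[where K = "cmod c"])
    (auto simp: scaleC_add_right scaleR_scaleC scaleC_scaleC norm_scaleC mult.commute[of c] mult.commute[of "cmod c"])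

lemma eq_if_cinner_eq: "(\<And>z. cinner x z = cinner y z) \<Longrightarrow> x = (y::'a::complex_inner)"
  by (metis cinner_diff_left cinner_self_eq_0 right_minus_eq)

lemma norm_eq_1_imp_cinner: "norm (x::'a::complex_inner) = 1 \<Longrightarrow> cinner x x = 1"
  by (simp add: cinner_self)

lemma norm_normalized: "x \<noteq> 0 \<Longrightarrow> norm (complex_of_real (1 / norm x) *\<^sub>C x) = (1::real)"
  for x :: "'a::complex_inner"
  by (simp add: norm_scaleC norm_divide)

section \<open>Bounded complex-linear operators\<close>

lemma bounded_clinearI:
  assumes "\<And>x y. T (x + y) = T x + T y" "\<And>c x. T (c *\<^sub>C x) = c *\<^sub>C T x"
    and "\<And>x. norm (T x) \<le> norm x * K"
  shows "bounded_clinear (T :: 'a::complex_inner \<Rightarrow> 'a)"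
  using assms unfolding bounded_clinear_def
  by (auto intro!: bounded_linear_intro[where K = K] simp: scaleR_scaleC)

context
  fixes T :: "'a::complex_inner \<Rightarrow> 'a"
  assumes T: "bounded_clinear T"
begin

lemma bounded_clinear_bounded_linear: "bounded_linear T"
  using T by (simp add: bounded_clinear_def)

interpretation bounded_linear T
  by (rule bounded_clinear_bounded_linear)

lemma bounded_clinear_add: "T (x + y) = T x + T y"
  by (rule add)

lemma bounded_clinear_diff: "T (x - y) = T x - T y"
  by (rule diff)

lemma bounded_clinear_zero: "T 0 = 0"
  by (rule zero)

lemma bounded_clinear_scaleC: "T (c *\<^sub>C x) = c *\<^sub>C T x"
  using T by (simp add: bounded_clinear_def)

lemma bounded_clinear_bound: "\<exists>M>0. \<forall>x. norm (T x) \<le> M * norm x"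
  using pos_bounded by (metis mult.commute)

end

lemma bounded_clinear_comp:
  "bounded_clinear S \<Longrightarrow> bounded_clinear T \<Longrightarrow> bounded_clinear (S \<circ> T)"
  by (auto simp: bounded_clinear_def o_def intro: bounded_linear_compose)

section \<open>Orthonormal families\<close>

text \<open>A family rather than a set: the same facts then serve sets of vectors, through
  \<open>\<lambda>x. x\<close>, and Schur bases, whose order matters.\<close>

definition corthonormal :: "('i \<Rightarrow> 'a::complex_inner) \<Rightarrow> 'i set \<Rightarrow> bool" where
  "corthonormal u I \<longleftrightarrow> (\<forall>i\<in>I. \<forall>j\<in>I. cinner (u i) (u j) = (if i = j then 1 else 0))"

lemma corthonormalD:
  "corthonormal u I \<Longrightarrow> i \<in> I \<Longrightarrow> j \<in> I \<Longrightarrow> cinner (u i) (u j) = (if i = j then 1 else 0)"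
  by (simp add: corthonormal_def)

lemma corthonormal_subset: "corthonormal u I \<Longrightarrow> J \<subseteq> I \<Longrightarrow> corthonormal u J"
  unfolding corthonormal_def by blast

lemma corthonormal_norm: "corthonormal u I \<Longrightarrow> i \<in> I \<Longrightarrow> norm (u i) = 1"
  using corthonormalD[of u I i i] Re_cinner_self[of "u i"] by (simp add: power2_eq_1_iff) (smt (verit) norm_ge_zero)

lemma cinner_corthonormal_sum:
  assumes "corthonormal u I" "finite F" "F \<subseteq> I" "i \<in> I"
  shows "cinner (\<Sum>j\<in>F. c j *\<^sub>C u j) (u i) = (if i \<in> F then c i else 0)"
proof -
  have "cinner (\<Sum>j\<in>F. c j *\<^sub>C u j) (u i) = (\<Sum>j\<in>F. if j = i then c j else 0)"
    unfolding cinner_sum_left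
    using assms by (intro sum.cong) (auto simp: cinner_scaleC_left corthonormalD[OF assms(1)] subset_iff)
  then show ?thesis
    using assms(2) by simp
qed

lemma norm_corthonormal_sum:
  assumes "corthonormal u F" "finite F"
  shows "(norm (\<Sum>j\<in>F. c j *\<^sub>C u j))\<^sup>2 = (\<Sum>j\<in>F. (cmod (c j))\<^sup>2)"
proof -
  define s where "s = (\<Sum>j\<in>F. c j *\<^sub>C u j)"
  have "cinner s s = (\<Sum>j\<in>F. cnj (c j) * cinner s (u j))"
    by (subst (2) s_def) (simp add: cinner_sum_right cinner_scaleC_right)
  also have "\<dots> = (\<Sum>j\<in>F. cnj (c j) * c j)"
    unfolding s_def using cinner_corthonormal_sum[OF assms(1,2) order_refl]
    by (intro sum.cong) auto
  also have "\<dots> = of_real (\<Sum>j\<in>F. (cmod (c j))\<^sup>2)"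
    by (simp add: complex_norm_square mult.commute del: of_real_power)
  finally show ?thesis
    unfolding cinner_self of_real_eq_iff s_def .
qed

lemma bessel_finite:
  assumes "corthonormal u F" "finite F"
  shows "(\<Sum>j\<in>F. (cmod (cinner x (u j)))\<^sup>2) \<le> (norm x)\<^sup>2"
proof -
  define s where "s = (\<Sum>j\<in>F. cinner x (u j) *\<^sub>C u j)"
  have s: "(norm s)\<^sup>2 = (\<Sum>j\<in>F. (cmod (cinner x (u j)))\<^sup>2)"
    unfolding s_def by (rule norm_corthonormal_sum[OF assms])
  have "cinner x s = (\<Sum>j\<in>F. cnj (cinner x (u j)) * cinner x (u j))"
    unfolding s_def by (simp add: cinner_sum_right cinner_scaleC_right)
  also have "\<dots> = of_real ((norm s)\<^sup>2)"
    unfolding s by (simp add: complex_norm_square mult.commute del: of_real_power)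
  finally have "(norm s)\<^sup>2 = cmod (cinner x s)"
    by (simp del: of_real_power)
  then have "norm s * norm s \<le> norm x * norm s"
    using cauchy_schwarz[of x s] by (simp add: power2_eq_square)
  then have "norm s \<le> norm x"
    by (cases "norm s = 0") (auto simp: mult_le_cancel_right)
  then show ?thesis
    unfolding s[symmetric] by simp
qed

text \<open>Riesz-Fischer: by Pythagoras the squared distance between partial sums over nested
  finite sets is a block of the scalar series, so the net of finite partial sums is Cauchy.\<close>

lemma corthonormal_summable:
  fixes u :: "'i \<Rightarrow> 'a::chilbert_space"
  assumes u: "corthonormal u I"
    and bound: "\<And>F. finite F \<Longrightarrow> F \<subseteq> I \<Longrightarrow> (\<Sum>i\<in>F. (cmod (c i))\<^sup>2) \<le> M"
  shows "(\<lambda>i. c i *\<^sub>C u i) summable_on I"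
proof -
  let ?g = "\<lambda>i. (cmod (c i))\<^sup>2" and ?f = "\<lambda>i. c i *\<^sub>C u i"
  have summ: "?g summable_on I"
    by (rule nonneg_bounded_partial_sums_imp_summable_on[where C = M])
      (auto intro!: eventually_finite_subsets_at_top_weakI bound)
  define L where "L = infsum ?g I"
  have L: "(sum ?g \<longlongrightarrow> L) (finite_subsets_at_top I)"
    using has_sum_infsum[OF summ] by (simp add: has_sum_def L_def)
  have le_L: "sum ?g F \<le> L" if "finite F" "F \<subseteq> I" for F
    unfolding L_def by (rule finite_sum_le_infsum[OF summ that]) auto
  have "\<exists>P. eventually P (finite_subsets_at_top I) \<and>
          (\<forall>F F'. P F \<and> P F' \<longrightarrow> dist (sum ?f F) (sum ?f F') < e)" if "e > 0" for e
  proof -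
    \<comment> \<open>Two finite sets are compared through their union, at a cost of
      \<open>e/2\<close> each; the square appears because the scalar series controls squared
      norms.\<close>
    define d where "d = (e/2)\<^sup>2"
    have "d > 0" using that by (simp add: d_def)
    define P where "P F \<longleftrightarrow> finite F \<and> F \<subseteq> I \<and> L - sum ?g F < d" for F
    have "\<forall>\<^sub>F F in finite_subsets_at_top I. dist (sum ?g F) L < d"
      using L \<open>d > 0\<close> by (rule tendstoD)
    moreover have "\<forall>\<^sub>F F in finite_subsets_at_top I. finite F \<and> F \<subseteq> I"
      by (auto intro!: eventually_finite_subsets_at_top_weakI)
    ultimately have ev: "eventually P (finite_subsets_at_top I)"
      by eventually_elim (auto simp: P_def dist_real_def)
    have half: "dist (sum ?f (F \<union> F')) (sum ?f F) < e/2" if "P F" "P F'" for F F'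
    proof -
      have fin: "finite (F \<union> F')" "F \<union> F' \<subseteq> I" using that by (auto simp: P_def)
      have "(dist (sum ?f (F \<union> F')) (sum ?f F))\<^sup>2 = (norm (sum ?f (F \<union> F' - F)))\<^sup>2"
        unfolding dist_norm using fin by (subst sum_diff) auto
      also have "\<dots> = sum ?g (F \<union> F' - F)"
        using fin by (intro norm_corthonormal_sum corthonormal_subset[OF u]) auto
      also have "\<dots> = sum ?g (F \<union> F') - sum ?g F"
        using fin by (subst sum_diff) auto
      also have "\<dots> < d"
        using le_L[OF fin] that(1) by (simp add: P_def)
      finally show ?thesis
        unfolding d_def using \<open>e > 0\<close> by (intro power2_less_imp_less[of _ "e/2"]) auto
    qed
    have "dist (sum ?f F) (sum ?f F') < e" if "P F" "P F'" for F F'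
    proof -
      have "dist (sum ?f F) (sum ?f F')
          \<le> dist (sum ?f (F \<union> F')) (sum ?f F) + dist (sum ?f (F \<union> F')) (sum ?f F')"
        by (rule dist_triangle3)
      also have "\<dots> < e/2 + e/2"
        using half[OF that] half[OF that(2,1)] by (intro add_strict_mono) (auto simp: Un_commute)
      finally show ?thesis by simp
    qed
    then show ?thesis
      using ev by blast
  qed
  then have "cauchy_filter (filtermap (sum ?f) (finite_subsets_at_top I))"
    by (simp add: cauchy_filter_metric_filtermap)
  moreover have "complete (UNIV::'a set)"
    by (meson Cauchy_convergent UNIV_I complete_def convergent_def)
  ultimately obtain L' where "(sum ?f \<longlongrightarrow> L') (finite_subsets_at_top I)"
    using complete_uniform[where S=UNIV] by (force simp add: filterlim_def)
  then show ?thesis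
    using summable_on_def has_sum_def by blast
qed

lemma cinner_corthonormal_has_sum:
  assumes "corthonormal u I" "((\<lambda>i. c i *\<^sub>C u i) has_sum s) I" "i \<in> I"
  shows "cinner s (u i) = c i"
proof -
  have "((\<lambda>j. cinner (c j *\<^sub>C u j) (u i)) has_sum cinner s (u i)) I"
    by (rule has_sum_bounded_linear[OF bounded_linear_cinner_left assms(2)])
  moreover have "((\<lambda>j. cinner (c j *\<^sub>C u j) (u i)) has_sum c i) I"
    by (rule has_sum_finite_neutralI[of "{i}"])
      (use assms in \<open>auto simp: cinner_scaleC_left corthonormalD\<close>)
  ultimately show ?thesis
    by (rule has_sum_unique)
qed

text \<open>Bessel's inequality makes the series converge; \<open>s\<close> is the orthogonal
  projection of \<open>x\<close> onto the closed span of the family.\<close>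

lemma corthonormal_expansion:
  fixes u :: "'i \<Rightarrow> 'a::chilbert_space"
  assumes u: "corthonormal u I"
  obtains s where "((\<lambda>i. cinner x (u i) *\<^sub>C u i) has_sum s) I"
    and "\<And>i. i \<in> I \<Longrightarrow> cinner (x - s) (u i) = 0"
proof -
  have "(\<lambda>i. cinner x (u i) *\<^sub>C u i) summable_on I"
    by (rule corthonormal_summable[OF u]) (auto intro: bessel_finite corthonormal_subset[OF u])
  then obtain s where s: "((\<lambda>i. cinner x (u i) *\<^sub>C u i) has_sum s) I"
    by (auto simp: summable_on_def)
  show ?thesis
    by (rule that[OF s]) (simp add: cinner_diff_left cinner_corthonormal_has_sum[OF u s])
qed

text \<open>The family need not be total. Continuity carries agreement from the \<open>u i\<close>
  to the projection of a vector, and \<open>off\<close> handles the remainder.\<close>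

lemma bounded_clinear_eqI:
  fixes u :: "'i \<Rightarrow> 'a::chilbert_space"
  assumes "bounded_clinear S" "bounded_clinear T" "corthonormal u I"
    and on: "\<And>i. i \<in> I \<Longrightarrow> S (u i) = T (u i)"
    and off: "\<And>x. (\<And>i. i \<in> I \<Longrightarrow> cinner x (u i) = 0) \<Longrightarrow> S x = T x"
  shows "S = T"
proof
  fix x
  obtain s where s: "((\<lambda>i. cinner x (u i) *\<^sub>C u i) has_sum s) I"
    and perp: "\<And>i. i \<in> I \<Longrightarrow> cinner (x - s) (u i) = 0"
    using corthonormal_expansion[OF assms(3)] by blast
  have "((\<lambda>i. S (cinner x (u i) *\<^sub>C u i)) has_sum S s) I"
    by (rule has_sum_bounded_linear[OF bounded_clinear_bounded_linear[OF assms(1)] s])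
  moreover have "((\<lambda>i. T (cinner x (u i) *\<^sub>C u i)) has_sum T s) I"
    by (rule has_sum_bounded_linear[OF bounded_clinear_bounded_linear[OF assms(2)] s])
  moreover have "S (cinner x (u i) *\<^sub>C u i) = T (cinner x (u i) *\<^sub>C u i)" if "i \<in> I" for i
    using on[OF that] by (simp add: bounded_clinear_scaleC assms)
  ultimately have "S s = T s"
    by (metis (mono_tags, lifting) has_sum_cong has_sum_unique)
  moreover have "S (x - s) = T (x - s)"
    by (rule off[OF perp])
  ultimately show "S x = T x"
    by (simp add: bounded_clinear_diff assms)
qed

text \<open>Zorn's lemma for an arbitrary set \<open>Q\<close>, not just a subspace:
  \<open>Q = UNIV\<close> gives a Hilbert basis, and the eigenvectors of
  \<open>adjoint_op K \<circ> K\<close> give the singular vectors.\<close>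

lemma corthonormal_maximal:
  fixes Q :: "'a::complex_inner set"
  obtains E where "corthonormal (\<lambda>x. x) E" "E \<subseteq> Q"
    and "\<And>x. x \<in> Q \<Longrightarrow> norm x = 1 \<Longrightarrow> \<exists>e\<in>E. cinner x e \<noteq> 0"
proof -
  define \<A> where "\<A> = {E. corthonormal (\<lambda>x. x) E \<and> E \<subseteq> Q}"
  have "\<Union>C \<in> \<A>" if "subset.chain \<A> C" for C
  proof -
    have "cinner x y = (if x = y then 1 else 0)" if "x \<in> \<Union>C" "y \<in> \<Union>C" for x y
    proof -
      obtain X Y where "X \<in> C" "x \<in> X" "Y \<in> C" "y \<in> Y" using \<open>x \<in> \<Union>C\<close> \<open>y \<in> \<Union>C\<close> by blast
      moreover have "X \<subseteq> Y \<or> Y \<subseteq> X"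
        using \<open>subset.chain \<A> C\<close> \<open>X \<in> C\<close> \<open>Y \<in> C\<close> by (simp add: subset_chain_def)
      ultimately obtain Z where "Z \<in> C" "x \<in> Z" "y \<in> Z"
        by blast
      then have "corthonormal (\<lambda>x. x) Z"
        using \<open>subset.chain \<A> C\<close> by (auto simp: subset_chain_def \<A>_def)
      from corthonormalD[OF this \<open>x \<in> Z\<close> \<open>y \<in> Z\<close>] show ?thesis .
    qed
    moreover have "\<Union>C \<subseteq> Q"
      using that by (auto simp: subset_chain_def \<A>_def)
    ultimately show ?thesis
      by (simp add: \<A>_def corthonormal_def)
  qed
  then obtain E where E: "E \<in> \<A>" and max: "\<And>X. X \<in> \<A> \<Longrightarrow> E \<subseteq> X \<Longrightarrow> X = E"
    using subset_Zorn'[of \<A>] by blast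
  show ?thesis
  proof (rule that)
    show "corthonormal (\<lambda>x. x) E" "E \<subseteq> Q" using E by (auto simp: \<A>_def)
    fix x assume x: "x \<in> Q" "norm x = 1"
    show "\<exists>e\<in>E. cinner x e \<noteq> 0"
    proof (rule ccontr)
      assume "\<not> ?thesis"
      then have orth: "cinner x e = 0" "cinner e x = 0" if "e \<in> E" for e
        using that cinner_eq_zero_commute[of x e] by auto
      have "cinner x x = 1" by (rule norm_eq_1_imp_cinner[OF x(2)])
      then have "x \<notin> E" using orth(1)[of x] by auto
      have "cinner a b = (if a = b then 1 else 0)" if "a \<in> insert x E" "b \<in> insert x E" for a b
      proof (cases "a = x \<or> b = x")
        case True
        with that orth \<open>cinner x x = 1\<close> \<open>x \<notin> E\<close> show ?thesis
          by (metis insertE)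
      next
        case False
        with that have "a \<in> E" "b \<in> E" by auto
        with E show ?thesis using corthonormalD[of "\<lambda>x. x" E a b] by (simp add: \<A>_def)
      qed
      with E x(1) have "insert x E \<in> \<A>"
        by (simp add: \<A>_def corthonormal_def)
      with max[OF this] \<open>x \<notin> E\<close> show False by blast
    qed
  qed
qed

section \<open>Adjoints\<close>

lemma riesz_representation:
  fixes f :: "'a::chilbert_space \<Rightarrow> complex"
  assumes f: "bounded_linear f" and fC: "\<And>c x. f (c *\<^sub>C x) = c * f x"
  obtains y where "\<And>x. f x = cinner x y"
proof -
  interpret f: bounded_linear f by fact
  obtain K where K: "K > 0" "\<And>x. cmod (f x) \<le> norm x * K" using f.pos_bounded by blast
  obtain E :: "'a set" where E: "corthonormal (\<lambda>x. x) E"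
    and max: "\<And>x. norm x = 1 \<Longrightarrow> \<exists>e\<in>E. cinner x e \<noteq> 0"
    using corthonormal_maximal[of UNIV] by (metis UNIV_I)
  have bound: "(\<Sum>e\<in>F. (cmod (cnj (f e)))\<^sup>2) \<le> K\<^sup>2" if F: "finite F" "F \<subseteq> E" for F
  proof -
    \<comment> \<open>A partial sum of the prospective representing vector. Testing \<open>f\<close>
      on it gives \<open>f v = (norm v)\<^sup>2\<close>, and boundedness of \<open>f\<close> then
      forces \<open>norm v \<le> K\<close>.\<close>
    define v where "v = (\<Sum>e\<in>F. cnj (f e) *\<^sub>C e)"
    have v: "(norm v)\<^sup>2 = (\<Sum>e\<in>F. (cmod (cnj (f e)))\<^sup>2)"
      unfolding v_def using norm_corthonormal_sum[OF corthonormal_subset[OF E F(2)] F(1)] .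
    have "f v = (\<Sum>e\<in>F. cnj (f e) * f e)"
      by (simp add: v_def f.sum fC)
    also have "\<dots> = of_real ((norm v)\<^sup>2)"
      unfolding v by (simp add: complex_norm_square mult.commute del: of_real_power)
    finally have "norm v * norm v \<le> norm v * K"
      using K(2)[of v] by (simp add: power2_eq_square norm_mult)
    then have "norm v \<le> K"
      using K(1) by (cases "norm v = 0") (auto simp: mult_le_cancel_left)
    then show ?thesis
      unfolding v[symmetric] by (intro power_mono) auto
  qed
  obtain y where y: "((\<lambda>e. cnj (f e) *\<^sub>C e) has_sum y) E"
    using corthonormal_summable[OF E bound] by (auto simp: summable_on_def)
  have ye: "cinner e y = f e" if "e \<in> E" for e
    using cinner_corthonormal_has_sum[OF E y that]
    by (metis cinner_commute complex_cnj_cnj)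
  show ?thesis
  proof (rule that)
    fix x
    obtain s where s: "((\<lambda>e. cinner x e *\<^sub>C e) has_sum s) E"
      and perp: "\<And>e. e \<in> E \<Longrightarrow> cinner (x - s) e = 0"
      using corthonormal_expansion[OF E] by blast
    have "x = s"
    proof (rule ccontr)
      assume "x \<noteq> s"
      then have "norm (complex_of_real (1 / norm (x - s)) *\<^sub>C (x - s)) = 1"
        by (intro norm_normalized) auto
      from max[OF this] perp show False
        by (auto simp: cinner_scaleC_left)
    qed
    have "((\<lambda>e. f (cinner x e *\<^sub>C e)) has_sum f x) E"
      using has_sum_bounded_linear[OF f s] \<open>x = s\<close> by simp
    moreover have "((\<lambda>e. cinner (cinner x e *\<^sub>C e) y) has_sum cinner x y) E"
      using has_sum_bounded_linear[OF bounded_linear_cinner_left s] \<open>x = s\<close> by simp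
    moreover have "f (cinner x e *\<^sub>C e) = cinner (cinner x e *\<^sub>C e) y" if "e \<in> E" for e
      using ye[OF that] by (simp add: fC cinner_scaleC_left)
    ultimately show "f x = cinner x y"
      by (metis (mono_tags, lifting) has_sum_cong has_sum_unique)
  qed
qed

lemma adjoint_op_exists:
  fixes K :: "'a::chilbert_space \<Rightarrow> 'a"
  assumes K: "bounded_clinear K"
  shows "\<exists>T. bounded_clinear T \<and> (\<forall>x y. cinner (K x) y = cinner x (T y))"
proof -
  obtain M where M: "M > 0" "\<And>x. norm (K x) \<le> M * norm x" using bounded_clinear_bound[OF K] by blast
  have "\<exists>z. \<forall>x. cinner (K x) y = cinner x z" for y
  proof -
    have "bounded_linear (\<lambda>x. cinner (K x) y)"
      by (rule bounded_linear_compose[OF bounded_linear_cinner_left bounded_clinear_bounded_linear[OF K]])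
    then show ?thesis
      by (rule riesz_representation) (auto simp: bounded_clinear_scaleC[OF K] cinner_scaleC_left)
  qed
  then obtain T where T: "\<And>x y. cinner (K x) y = cinner x (T y)" by metis
  have eqI: "v = w" if "\<And>x. cinner x v = cinner x w" for v w :: 'a
    using that by (intro eq_if_cinner_eq) (metis cinner_commute)
  have "bounded_clinear T"
  proof (rule bounded_clinearI[where K = M])
    fix x y c
    show "T (x + y) = T x + T y" by (rule eqI) (simp add: cinner_add_right flip: T)
    show "T (c *\<^sub>C x) = c *\<^sub>C T x" by (rule eqI) (simp add: cinner_scaleC_right flip: T)
    have "norm (T x) * norm (T x) = cmod (cinner (T x) (T x))"
      by (simp add: cinner_self power2_eq_square norm_mult)
    also have "\<dots> \<le> norm (K (T x)) * norm x"
      by (simp add: cauchy_schwarz flip: T)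
    also have "\<dots> \<le> norm (T x) * (norm x * M)"
      using mult_right_mono[OF M(2)[of "T x"], of "norm x"] by (simp add: mult_ac)
    finally show "norm (T x) \<le> norm x * M"
      using M(1) by (cases "norm (T x) = 0") (auto simp: mult_le_cancel_left)
  qed
  with T show ?thesis by blast
qed

lemma adjoint_op:
  fixes K :: "'a::chilbert_space \<Rightarrow> 'a"
  assumes K: "bounded_clinear K"
  shows "bounded_clinear (adjoint_op K)" and "cinner (K x) y = cinner x (adjoint_op K y)"
proof -
  have "\<exists>!T. bounded_clinear T \<and> (\<forall>x y. cinner (K x) y = cinner x (T y))"
  proof (rule ex_ex1I[OF adjoint_op_exists[OF K]])
    fix S T assume *: "bounded_clinear S \<and> (\<forall>x y. cinner (K x) y = cinner x (S y))"
      "bounded_clinear T \<and> (\<forall>x y. cinner (K x) y = cinner x (T y))"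
    show "S = T"
      by (rule ext, rule eq_if_cinner_eq) (metis * cinner_commute)
  qed
  from theI'[OF this] show "bounded_clinear (adjoint_op K)"
    "cinner (K x) y = cinner x (adjoint_op K y)"
    unfolding adjoint_op_def by blast+
qed

section \<open>The spectral theorem for \<open>K\<^sup>*K\<close>\<close>

lemma compact_operator_bounded_clinear: "compact_operator K \<Longrightarrow> bounded_clinear K"
  by (simp add: compact_operator_def)

lemma compact_operator_subseq:
  assumes K: "compact_operator K" and x: "\<And>n::nat. norm (x n) \<le> 1"
  obtains l r where "strict_mono r" "(\<lambda>n. K (x (r n))) \<longlonglongrightarrow> l"
proof -
  have "seq_compact (closure (K ` cball 0 1))"
    using K by (intro compact_imp_seq_compact) (simp add: compact_operator_def)
  moreover have "\<forall>n. K (x n) \<in> closure (K ` cball 0 1)"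
    using x by (intro allI subsetD[OF closure_subset] imageI) simp
  ultimately obtain l r where "strict_mono r" "((\<lambda>n. K (x n)) \<circ> r) \<longlonglongrightarrow> l"
    by (rule seq_compactE)
  then show ?thesis by (intro that) (simp_all add: o_def)
qed

lemma cinner_adjoint_comp:
  fixes K :: "'a::chilbert_space \<Rightarrow> 'a"
  assumes "bounded_clinear K"
  shows "cinner (adjoint_op K (K x)) y = cinner (K x) (K y)"
    and "cinner y (adjoint_op K (K x)) = cinner (K y) (K x)"
  using adjoint_op(2)[OF assms] by (metis cinner_commute)+

lemma tendsto_bounded_clinear:
  "bounded_clinear T \<Longrightarrow> (f \<longlongrightarrow> l) F \<Longrightarrow> ((\<lambda>x. T (f x)) \<longlongrightarrow> T l) F"
  by (rule bounded_linear.tendsto[OF bounded_clinear_bounded_linear])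

text \<open>With \<open>M\<close> the supremum of \<open>\<parallel>K x\<parallel>\<close> over the unit vectors of \<open>N\<close>, a maximizing sequence
  satisfies \<open>\<parallel>K\<^sup>*K x\<^sub>n - M\<^sup>2 x\<^sub>n\<parallel>\<^sup>2 \<le> 2M\<^sup>4 - 2M\<^sup>2 \<parallel>K x\<^sub>n\<parallel>\<^sup>2\<close>, which tends to \<open>0\<close>.\<close>

lemma compact_singular_vector:
  fixes K :: "'a::chilbert_space \<Rightarrow> 'a"
  assumes K: "compact_operator K"
    and N: "closed N" "complex_vector.subspace N"
    and inv: "\<And>x. x \<in> N \<Longrightarrow> adjoint_op K (K x) \<in> N"
    and x0: "x0 \<in> N" "K x0 \<noteq> 0"
  obtains x s where "x \<in> N" "norm x = 1" "s > 0" "adjoint_op K (K x) = complex_of_real (s\<^sup>2) *\<^sub>C x"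
proof -
  note Kb = compact_operator_bounded_clinear[OF K]
  let ?T = "\<lambda>x. adjoint_op K (K x)"
  obtain C where C: "C > 0" "\<And>x. norm (K x) \<le> C * norm x" using bounded_clinear_bound[OF Kb] by blast
  define S where "S = {norm (K x) | x. x \<in> N \<and> norm x = 1}"
  define M where "M = Sup S"
  have bdd: "bdd_above S"
  proof (rule bdd_aboveI)
    fix t assume "t \<in> S"
    then show "t \<le> C" using C(2) by (auto simp: S_def) (metis mult.right_neutral)
  qed
  have le_M: "norm (K x) \<le> M * norm x" if "x \<in> N" for x
  proof (cases "x = 0")
    case False
    define y where "y = complex_of_real (1 / norm x) *\<^sub>C x"
    have "norm y = 1" unfolding y_def by (rule norm_normalized[OF False])
    moreover have "y \<in> N" unfolding y_def using N(2) that by (rule complex_vector.subspace_scale)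
    ultimately have "norm (K y) \<le> M"
      unfolding M_def by (intro cSup_upper bdd) (auto simp: S_def)
    also have "norm (K y) = norm (K x) / norm x"
      by (simp add: y_def bounded_clinear_scaleC[OF Kb] norm_scaleC norm_divide)
    finally show ?thesis using False by (simp add: field_simps)
  qed (simp add: bounded_clinear_zero[OF Kb])
  have "x0 \<noteq> 0" using x0(2) bounded_clinear_zero[OF Kb] by auto
  then have "M > 0"
    using le_M[OF x0(1)] x0(2) by (smt (verit) norm_le_zero_iff zero_less_norm_iff mult_nonpos_nonneg)
  have "S \<noteq> {}"
  proof -
    have "norm (K (complex_of_real (1 / norm x0) *\<^sub>C x0)) \<in> S"
      unfolding S_def using norm_normalized[OF \<open>x0 \<noteq> 0\<close>] complex_vector.subspace_scale[OF N(2) x0(1)]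
      by blast
    then show ?thesis by blast
  qed
  have "\<exists>x\<in>N. norm x = 1 \<and> M - 1 / Suc n < norm (K x)" for n
  proof -
    have "M - 1 / Suc n < Sup S" by (simp add: M_def)
    then obtain t where "t \<in> S" "M - 1 / Suc n < t" using less_cSup_iff[OF \<open>S \<noteq> {}\<close> bdd] by blast
    then show ?thesis by (auto simp: S_def)
  qed
  then obtain x where xN: "\<And>n. x n \<in> N" and x1: "\<And>n. norm (x n) = 1"
    and xM: "\<And>n. M - 1 / Suc n < norm (K (x n))" by metis
  have upper: "norm (K (x n)) \<le> M" for n using le_M[OF xN[of n]] x1[of n] by simp
  have KM: "(\<lambda>n. norm (K (x n))) \<longlonglongrightarrow> M"
  proof (rule real_tendsto_sandwich)
    show "(\<lambda>n. M - 1 / Suc n) \<longlonglongrightarrow> M"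
      using tendsto_diff[OF tendsto_const[of M] LIMSEQ_inverse_real_of_nat] by (simp add: inverse_eq_divide)
    show "(\<lambda>n. M) \<longlonglongrightarrow> M" by simp
  qed (use xM upper in \<open>auto simp: less_imp_le\<close>)
  \<comment> \<open>\<open>M\<close> bounds \<open>K\<close> on \<open>N\<close> only, so bounding
    \<open>K\<close> at \<open>?T (x n)\<close> relies on the invariance of
    \<open>N\<close>.\<close>
  have T_le: "norm (?T (x n)) \<le> M\<^sup>2" for n
  proof -
    have "norm (?T (x n)) * norm (?T (x n)) = cmod (cinner (?T (x n)) (?T (x n)))"
      by (simp add: cinner_self power2_eq_square norm_mult)
    also have "\<dots> = cmod (cinner (K (x n)) (K (?T (x n))))"
      by (simp add: cinner_adjoint_comp[OF Kb] cmod_cinner_commute[of "K (x n)"])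
    also have "\<dots> \<le> norm (K (x n)) * norm (K (?T (x n)))" by (rule cauchy_schwarz)
    also have "\<dots> \<le> M * (M * norm (?T (x n)))"
      using upper le_M[OF inv[OF xN]] \<open>M > 0\<close> by (intro mult_mono) auto
    finally have "norm (?T (x n)) * norm (?T (x n)) \<le> M\<^sup>2 * norm (?T (x n))"
      by (simp add: power2_eq_square)
    then show ?thesis by (cases "norm (?T (x n)) = 0") (auto simp: mult_le_cancel_right)
  qed
  have near: "(norm (?T (x n) - M\<^sup>2 *\<^sub>R x n))\<^sup>2 \<le> 2 * M^4 - 2 * M\<^sup>2 * (norm (K (x n)))\<^sup>2" for n
  proof -
    have expand: "cinner (w - M\<^sup>2 *\<^sub>R v) (w - M\<^sup>2 *\<^sub>R v)
        = cinner w w - 2 * of_real (M\<^sup>2) * k + of_real (M^4) * cinner v v"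
      if "cinner w v = k" "cinner v w = k" for v w :: 'a and k
      by (simp add: cinner_diff_left cinner_diff_right cinner_scaleR_left cinner_scaleR_right
          that algebra_simps power4_eq_xxxx power2_eq_square)
    have "cinner (?T (x n) - M\<^sup>2 *\<^sub>R x n) (?T (x n) - M\<^sup>2 *\<^sub>R x n)
        = cinner (?T (x n)) (?T (x n)) - 2 * of_real (M\<^sup>2) * cinner (K (x n)) (K (x n))
          + of_real (M^4) * cinner (x n) (x n)"
      by (rule expand) (rule cinner_adjoint_comp[OF Kb])+
    then have "complex_of_real ((norm (?T (x n) - M\<^sup>2 *\<^sub>R x n))\<^sup>2)
        = of_real ((norm (?T (x n)))\<^sup>2 - 2 * M\<^sup>2 * (norm (K (x n)))\<^sup>2 + M^4)"
      by (simp add: cinner_self x1)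
    then have "(norm (?T (x n) - M\<^sup>2 *\<^sub>R x n))\<^sup>2
        = (norm (?T (x n)))\<^sup>2 - 2 * M\<^sup>2 * (norm (K (x n)))\<^sup>2 + M^4"
      unfolding of_real_eq_iff .
    moreover have "(norm (?T (x n)))\<^sup>2 \<le> M^4"
      using power_mono[OF T_le[of n], of 2] by simp
    ultimately show ?thesis by simp
  qed
  have "(\<lambda>n. (norm (?T (x n) - M\<^sup>2 *\<^sub>R x n))\<^sup>2) \<longlonglongrightarrow> 0"
  proof (rule real_tendsto_sandwich)
    show "(\<lambda>n. 0) \<longlonglongrightarrow> (0::real)" by simp
    have "(\<lambda>n. 2 * M^4 - 2 * M\<^sup>2 * (norm (K (x n)))\<^sup>2) \<longlonglongrightarrow> 2 * M^4 - 2 * M\<^sup>2 * M\<^sup>2"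
      by (intro tendsto_intros KM)
    then show "(\<lambda>n. 2 * M^4 - 2 * M\<^sup>2 * (norm (K (x n)))\<^sup>2) \<longlonglongrightarrow> 0"
      by (simp add: power4_eq_xxxx power2_eq_square)
  qed (use near in auto)
  then have "(\<lambda>n. sqrt ((norm (?T (x n) - M\<^sup>2 *\<^sub>R x n))\<^sup>2)) \<longlonglongrightarrow> sqrt 0"
    by (rule tendsto_real_sqrt)
  then have to0: "(\<lambda>n. ?T (x n) - M\<^sup>2 *\<^sub>R x n) \<longlonglongrightarrow> 0"
    by (simp add: tendsto_norm_zero_iff)
  have "norm (x n) \<le> 1" for n using x1[of n] by simp
  then obtain l r where r: "strict_mono r" and l: "(\<lambda>n. K (x (r n))) \<longlonglongrightarrow> l"
    by (rule compact_operator_subseq[OF K])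
  \<comment> \<open>Compactness makes only \<open>K (x (r n))\<close> converge. Then
    \<open>?T (x (r n))\<close> converges too and differs from
    \<open>M\<^sup>2 *\<^sub>R x (r n)\<close> by a null sequence, so \<open>M > 0\<close> gives
    convergence of the vectors themselves.\<close>
  have "(\<lambda>n. ?T (x (r n)) - M\<^sup>2 *\<^sub>R x (r n)) \<longlonglongrightarrow> 0"
    using LIMSEQ_subseq_LIMSEQ[OF to0 r] by (simp add: o_def)
  moreover have Tl: "(\<lambda>n. ?T (x (r n))) \<longlonglongrightarrow> adjoint_op K l"
    by (rule tendsto_bounded_clinear[OF adjoint_op(1)[OF Kb] l])
  ultimately have "(\<lambda>n. ?T (x (r n)) - (?T (x (r n)) - M\<^sup>2 *\<^sub>R x (r n))) \<longlonglongrightarrow> adjoint_op K l - 0"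
    by (intro tendsto_diff)
  then have "(\<lambda>n. (1 / M\<^sup>2) *\<^sub>R (M\<^sup>2 *\<^sub>R x (r n))) \<longlonglongrightarrow> (1 / M\<^sup>2) *\<^sub>R adjoint_op K l"
    by (intro tendsto_scaleR tendsto_const) simp
  moreover define y where "y = (1 / M\<^sup>2) *\<^sub>R adjoint_op K l"
  ultimately have y: "(\<lambda>n. x (r n)) \<longlonglongrightarrow> y"
    using \<open>M > 0\<close> by simp
  have "(\<lambda>n. ?T (x (r n))) \<longlonglongrightarrow> ?T y"
    by (intro tendsto_bounded_clinear[OF adjoint_op(1)[OF Kb]] tendsto_bounded_clinear[OF Kb] y)
  with Tl have "?T y = adjoint_op K l"
    using LIMSEQ_unique by blast
  then have "?T y = complex_of_real (M\<^sup>2) *\<^sub>C y"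
    using \<open>M > 0\<close> by (simp add: y_def scaleC_scaleC scaleR_scaleC flip: of_real_mult)
  moreover have "y \<in> N"
    using closed_sequentially[OF N(1) _ y] xN by blast
  moreover have "norm y = 1"
    using tendsto_norm[OF y] x1 LIMSEQ_unique[OF _ tendsto_const] by simp
  ultimately show ?thesis using \<open>M > 0\<close> that by blast
qed

lemma subspace_orthogonal: "complex_vector.subspace {x::'a::complex_inner. \<forall>e\<in>E. cinner x e = 0}"
  by (rule complex_vector.subspaceI) (auto simp: cinner_add_left cinner_scaleC_left)

lemma closed_orthogonal: "closed {x::'a::complex_inner. \<forall>e\<in>E. cinner x e = 0}"
proof -
  have "closed {x. cinner x e = 0}" for e :: 'a
    by (intro closed_Collect_eq continuous_on_const linear_continuous_on bounded_linear_cinner_left)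
  then show ?thesis
    unfolding Collect_ball_eq by (intro closed_INT) auto
qed

text \<open>For a maximal orthonormal set \<open>E\<close> of eigenvectors with positive eigenvalue,
  the orthogonal complement is closed and invariant under \<open>adjoint_op K \<circ> K\<close>. If
  \<open>K\<close> did not vanish there, it would contain a further unit eigenvector, against
  maximality.\<close>

lemma singular_system:
  fixes K :: "'a::chilbert_space \<Rightarrow> 'a"
  assumes K: "compact_operator K"
  obtains E where "corthonormal (\<lambda>x. x) E"
    and "\<And>e. e \<in> E \<Longrightarrow> norm (K e) > 0"
    and "\<And>e. e \<in> E \<Longrightarrow> adjoint_op K (K e) = complex_of_real ((norm (K e))\<^sup>2) *\<^sub>C e"
    and "\<And>x. (\<And>e. e \<in> E \<Longrightarrow> cinner x e = 0) \<Longrightarrow> K x = 0"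
proof -
  note Kb = compact_operator_bounded_clinear[OF K]
  define Q where "Q = {x. \<exists>s>0. adjoint_op K (K x) = complex_of_real (s\<^sup>2) *\<^sub>C x}"
  obtain E where E: "corthonormal (\<lambda>x. x) E" "E \<subseteq> Q"
    and max: "\<And>x. x \<in> Q \<Longrightarrow> norm x = 1 \<Longrightarrow> \<exists>e\<in>E. cinner x e \<noteq> 0"
    using corthonormal_maximal[of Q] by blast
  have ev: "norm (K e) > 0 \<and> adjoint_op K (K e) = complex_of_real ((norm (K e))\<^sup>2) *\<^sub>C e" if "e \<in> E" for e
  proof -
    have "e \<in> Q" using that E(2) by blast
    then obtain s where s: "s > 0" "adjoint_op K (K e) = complex_of_real (s\<^sup>2) *\<^sub>C e"
      unfolding Q_def by blast
    \<comment> \<open>Pairing with the unit vector \<open>e\<close> identifies the unknown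
      \<open>s\<close> as \<open>norm (K e)\<close>.\<close>
    have "cinner (adjoint_op K (K e)) e = of_real (s\<^sup>2)"
      using corthonormalD[OF E(1) that that] by (simp add: s(2) cinner_scaleC_left)
    then have "(norm (K e))\<^sup>2 = s\<^sup>2"
      unfolding cinner_adjoint_comp[OF Kb] cinner_self of_real_eq_iff .
    then show ?thesis using s by (auto simp: power2_eq_iff)
  qed
  show ?thesis
  proof (rule that[OF E(1)])
    fix x assume x: "\<And>e. e \<in> E \<Longrightarrow> cinner x e = 0"
    show "K x = 0"
    proof (rule ccontr)
      assume "K x \<noteq> 0"
      let ?N = "{x. \<forall>e\<in>E. cinner x e = 0}"
      have inv: "adjoint_op K (K y) \<in> ?N" if "y \<in> ?N" for y
      proof -
        have "cinner (adjoint_op K (K y)) e = 0" if "e \<in> E" for e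
        proof -
          have "cinner (adjoint_op K (K y)) e = cinner y (adjoint_op K (K e))"
            by (simp add: cinner_adjoint_comp[OF Kb])
          also have "\<dots> = 0"
            using ev[OF that] \<open>y \<in> ?N\<close> that by (simp add: cinner_scaleC_right)
          finally show ?thesis .
        qed
        then show ?thesis by simp
      qed
      obtain y s where y: "y \<in> ?N" "norm y = 1" and s: "s > 0"
        "adjoint_op K (K y) = complex_of_real (s\<^sup>2) *\<^sub>C y"
        using compact_singular_vector[OF K closed_orthogonal subspace_orthogonal inv _ \<open>K x \<noteq> 0\<close>] x
        by blast
      then have "y \<in> Q" unfolding Q_def by blast
      from max[OF this y(2)] y(1) show False by blast
    qed
  qed (use ev in blast)+
qed

section \<open>The modulus of a compact operator\<close>

lemma diagonal_operator_exists:
  fixes u :: "'i \<Rightarrow> 'a::chilbert_space"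
  assumes u: "corthonormal u I" and c: "\<And>i. i \<in> I \<Longrightarrow> cmod (c i) \<le> M"
  obtains P where "bounded_clinear P"
    and "\<And>x. ((\<lambda>i. (c i * cinner x (u i)) *\<^sub>C u i) has_sum P x) I"
proof -
  let ?f = "\<lambda>x i. (c i * cinner x (u i)) *\<^sub>C u i"
  have bound: "(\<Sum>i\<in>F. (cmod (c i * cinner x (u i)))\<^sup>2) \<le> (norm x * M)\<^sup>2"
    if F: "finite F" "F \<subseteq> I" for F x
  proof -
    have "(\<Sum>i\<in>F. (cmod (c i * cinner x (u i)))\<^sup>2) \<le> (\<Sum>i\<in>F. M\<^sup>2 * (cmod (cinner x (u i)))\<^sup>2)"
      unfolding norm_mult power_mult_distrib using F c
      by (intro sum_mono mult_right_mono power_mono) auto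
    also have "\<dots> \<le> M\<^sup>2 * (norm x)\<^sup>2"
      unfolding sum_distrib_left[symmetric]
      by (intro mult_left_mono bessel_finite corthonormal_subset[OF u F(2)] F(1)) simp
    finally show ?thesis by (simp add: power_mult_distrib mult.commute)
  qed
  define P where "P x = infsum (?f x) I" for x
  have P: "(?f x has_sum P x) I" for x
    unfolding P_def using corthonormal_summable[OF u bound] by (rule has_sum_infsum)
  have "bounded_clinear P"
  \<comment> \<open>For empty \<open>I\<close> the number \<open>M\<close> may be negative, hence
    the absolute value.\<close>
  proof (rule bounded_clinearI[where K = "\<bar>M\<bar>"])
    fix x y :: 'a and d
    have "((\<lambda>i. ?f x i + ?f y i) has_sum (P x + P y)) I"
      by (rule has_sum_add[OF P P])
    then show "P (x + y) = P x + P y"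
      using has_sum_unique[OF P[of "x + y"]]
      by (simp add: cinner_add_left algebra_simps complex_vector.scale_left_distrib)
    have "((\<lambda>i. d *\<^sub>C ?f x i) has_sum d *\<^sub>C P x) I"
      by (rule has_sum_bounded_linear[OF bounded_linear_scaleC P])
    then show "P (d *\<^sub>C x) = d *\<^sub>C P x"
      using has_sum_unique[OF P[of "d *\<^sub>C x"]]
      by (simp add: cinner_scaleC_left scaleC_scaleC mult_ac)
    show "norm (P x) \<le> norm x * \<bar>M\<bar>"
    proof (rule tendsto_upperbound)
      show "((\<lambda>F. norm (sum (?f x) F)) \<longlongrightarrow> norm (P x)) (finite_subsets_at_top I)"
        using P[of x] unfolding has_sum_def by (rule tendsto_norm)
      have "norm (sum (?f x) F) \<le> norm x * \<bar>M\<bar>" if F: "finite F" "F \<subseteq> I" for F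
      proof -
        have "(norm (sum (?f x) F))\<^sup>2 \<le> (norm x * M)\<^sup>2"
          using norm_corthonormal_sum[OF corthonormal_subset[OF u F(2)] F(1)] bound[OF F] by simp
        then show ?thesis
          by (simp add: abs_le_square_iff[symmetric] abs_mult)
      qed
      then show "\<forall>\<^sub>F F in finite_subsets_at_top I. norm (sum (?f x) F) \<le> norm x * \<bar>M\<bar>"
        by (intro eventually_finite_subsets_at_top_weakI)
    qed simp
  qed
  then show ?thesis by (rule that[OF _ P])
qed

text \<open>Polarization: the quadratic form is real at \<open>x + y\<close> and at
  \<open>x + \<i> *\<^sub>C y\<close>, which determines the imaginary and the real part of the
  difference of the two sides.\<close>

lemma positive_op_selfadjoint:
  assumes Q: "positive_op Q"
  shows "cinner (Q x) y = cinner x (Q y)"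
proof -
  have Qb: "bounded_clinear Q" using Q by (simp add: positive_op_def)
  have Im: "Im (cinner (Q x) x) = 0" for x
    using Q by (auto simp: positive_op_def complex_nonneg_Reals_iff)
  define a b where "a = cinner (Q x) y" and "b = cinner (Q y) x"
  have "Im (a + b) = 0"
    using Im[of "x + y"] Im[of x] Im[of y]
    by (simp add: a_def b_def bounded_clinear_add[OF Qb] cinner_simps)
  moreover have "Im (\<i> * (b - a)) = 0"
    using Im[of "x + \<i> *\<^sub>C y"] Im[of x] Im[of y]
    by (simp add: a_def b_def bounded_clinear_add[OF Qb] bounded_clinear_scaleC[OF Qb] cinner_simps
        algebra_simps)
  ultimately have "a = cnj b" by (simp add: complex_eq_iff)
  then show ?thesis
    unfolding a_def b_def by (metis cinner_commute)
qed

text \<open>A positive square root \<open>Q\<close> of \<open>K\<^sup>*K\<close> acts on an eigenvector \<open>e\<close> with eigenvalue \<open>\<sigma>\<^sup>2\<close> as \<open>\<sigma>\<close>: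
  the vector \<open>y = Q e - \<sigma> e\<close> satisfies \<open>Q y = - \<sigma> y\<close>, so positivity forces \<open>y = 0\<close>.\<close>

lemma positive_sqrt_eigenvector:
  assumes Q: "positive_op Q" and QQ: "Q (Q e) = complex_of_real (s\<^sup>2) *\<^sub>C e" and s: "s > 0"
  shows "Q e = complex_of_real s *\<^sub>C e"
proof -
  have Qb: "bounded_clinear Q" using Q by (simp add: positive_op_def)
  define y where "y = Q e - complex_of_real s *\<^sub>C e"
  have "Q y = - complex_of_real s *\<^sub>C y"
    unfolding y_def
    by (simp add: bounded_clinear_diff[OF Qb] bounded_clinear_scaleC[OF Qb] QQ
        complex_vector.scale_right_diff_distrib scaleC_scaleC power2_eq_square
        complex_vector.scale_minus_left)
  then have "cinner (Q y) y = complex_of_real (- s * (norm y)\<^sup>2)"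
    by (simp add: cinner_self cinner_minus_left cinner_scaleC_left complex_vector.scale_minus_left)
  then have "- s * (norm y)\<^sup>2 \<ge> 0"
    using Q unfolding positive_op_def by (metis nonneg_Reals_of_real_iff)
  with s have "y = 0" by (simp add: mult_le_0_iff zero_le_mult_iff)
  then show ?thesis by (simp add: y_def)
qed

text \<open>Self-adjointness gives \<open>cinner (Q x) (Q x) = cinner (Q (Q x)) x\<close>. This
  settles uniqueness of the square root orthogonally to the singular vectors.\<close>

lemma positive_sqrt_kernel:
  assumes Q: "positive_op Q" and QQ: "Q (Q x) = 0"
  shows "Q x = 0"
  by (metis QQ cinner_self_eq_0 cinner_zero_left positive_op_selfadjoint[OF Q])

text \<open>\<open>E\<close> consists of right singular vectors, with singular values
  \<open>norm (K e)\<close>; it is a Hilbert basis of the orthogonal complement of the kernel of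
  \<open>K\<close>, not of the whole space.\<close>

locale singular_basis =
  fixes K :: "'a::chilbert_space \<Rightarrow> 'a" and E :: "'a set"
  assumes compact: "compact_operator K"
    and orthonormal: "corthonormal (\<lambda>x. x) E"
    and norm_pos: "e \<in> E \<Longrightarrow> norm (K e) > 0"
    and adjoint_eigen: "e \<in> E \<Longrightarrow> adjoint_op K (K e) = complex_of_real ((norm (K e))\<^sup>2) *\<^sub>C e"
    and kernel: "(\<And>e. e \<in> E \<Longrightarrow> cinner x e = 0) \<Longrightarrow> K x = 0"
    and positive_modulus: "positive_op (modulus_op K)"
    and modulus_eigen: "e \<in> E \<Longrightarrow> modulus_op K e = complex_of_real (norm (K e)) *\<^sub>C e"
    and modulus_kernel: "(\<And>e. e \<in> E \<Longrightarrow> cinner x e = 0) \<Longrightarrow> modulus_op K x = 0"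

text \<open>The diagonal operator with entries \<open>norm (K e)\<close> is a positive square root.
  Any other one agrees with it on \<open>E\<close>, by its action on eigenvectors, and orthogonally
  to \<open>E\<close>, where its square vanishes; so the definite description of the modulus denotes
  it.\<close>

lemma singular_basis_exists:
  fixes K :: "'a::chilbert_space \<Rightarrow> 'a"
  assumes K: "compact_operator K"
  shows "\<exists>E. singular_basis K E"
proof -
  note Kb = compact_operator_bounded_clinear[OF K]
  note T = adjoint_op(1)[OF Kb]
  obtain E where E: "corthonormal (\<lambda>x. x) E"
    and pos: "\<And>e. e \<in> E \<Longrightarrow> norm (K e) > 0"
    and ev: "\<And>e. e \<in> E \<Longrightarrow> adjoint_op K (K e) = complex_of_real ((norm (K e))\<^sup>2) *\<^sub>C e"
    and ker: "\<And>x. (\<And>e. e \<in> E \<Longrightarrow> cinner x e = 0) \<Longrightarrow> K x = 0"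
    using singular_system[OF K] by metis
  obtain C where C: "C > 0" "\<And>x. norm (K x) \<le> C * norm x" using bounded_clinear_bound[OF Kb] by blast
  have "cmod (complex_of_real (norm (K e))) \<le> C" if "e \<in> E" for e
    using C(2)[of e] corthonormal_norm[OF E that] by simp
  then obtain P where P: "bounded_clinear P"
    and Psum: "\<And>x. ((\<lambda>e. (complex_of_real (norm (K e)) * cinner x e) *\<^sub>C e) has_sum P x) E"
    using diagonal_operator_exists[OF E, of "\<lambda>e. complex_of_real (norm (K e))" C] by metis
  have Pe: "P e = complex_of_real (norm (K e)) *\<^sub>C e" if "e \<in> E" for e
  proof -
    have "((\<lambda>e'. (complex_of_real (norm (K e')) * cinner e e') *\<^sub>C e')
        has_sum complex_of_real (norm (K e)) *\<^sub>C e) E"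
      by (rule has_sum_finite_neutralI[of "{e}"])
        (use that corthonormalD[OF E] in auto)
    then show ?thesis using has_sum_unique[OF Psum] by blast
  qed
  have Pker: "P x = 0" if "\<And>e. e \<in> E \<Longrightarrow> cinner x e = 0" for x
  proof -
    have "((\<lambda>e. (complex_of_real (norm (K e)) * cinner x e) *\<^sub>C e) has_sum 0) E"
      by (rule has_sum_0) (simp add: that)
    then show ?thesis using has_sum_unique[OF Psum] by blast
  qed
  have Ppos: "positive_op P"
    unfolding positive_op_def
  proof (intro conjI allI P)
    fix x
    have "((\<lambda>e. cinner ((complex_of_real (norm (K e)) * cinner x e) *\<^sub>C e) x) has_sum cinner (P x) x) E"
      by (rule has_sum_bounded_linear[OF bounded_linear_cinner_left Psum])
    moreover have nonneg: "cinner ((complex_of_real (norm (K e)) * cinner x e) *\<^sub>C e) x \<in> \<real>\<^sub>\<ge>\<^sub>0" for e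
    proof -
      have "cinner ((complex_of_real (norm (K e)) * cinner x e) *\<^sub>C e) x
          = complex_of_real (norm (K e)) * (cinner x e * cnj (cinner x e))"
        by (simp add: cinner_scaleC_left cinner_commute[of e x])
      then show ?thesis
        by (simp add: complex_norm_square[symmetric] flip: of_real_mult of_real_power)
    qed
    moreover have "(\<Sum>e\<in>F. cinner ((complex_of_real (norm (K e)) * cinner x e) *\<^sub>C e) x) \<in> \<real>\<^sub>\<ge>\<^sub>0" for F
      using nonneg unfolding complex_nonneg_Reals_iff by (simp add: Re_sum Im_sum sum_nonneg)
    ultimately show "cinner (P x) x \<in> \<real>\<^sub>\<ge>\<^sub>0"
      unfolding has_sum_def
      by (intro Lim_in_closed_set[OF closed_nonneg_Reals_complex always_eventually
            finite_subsets_at_top_neq_bot]) auto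
  qed
  have "P \<circ> P = adjoint_op K \<circ> K"
  proof (rule bounded_clinear_eqI[OF bounded_clinear_comp[OF P P] bounded_clinear_comp[OF T Kb] E])
    fix e assume "e \<in> E"
    then show "(P \<circ> P) e = (adjoint_op K \<circ> K) e"
      by (simp add: Pe ev bounded_clinear_scaleC[OF P] scaleC_scaleC power2_eq_square)
  next
    fix x assume "\<And>e. e \<in> E \<Longrightarrow> cinner x e = 0"
    then show "(P \<circ> P) x = (adjoint_op K \<circ> K) x"
      using Pker[of x] ker[of x] by (simp add: bounded_clinear_zero P T)
  qed
  moreover have "Q = P" if Q: "positive_op Q" and QQ: "Q \<circ> Q = adjoint_op K \<circ> K" for Q
  proof (rule bounded_clinear_eqI[OF _ P E])
    have QQ': "Q (Q x) = adjoint_op K (K x)" for x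
      using fun_cong[OF QQ, of x] by simp
    show "bounded_clinear Q" using Q by (simp add: positive_op_def)
    show "Q e = P e" if "e \<in> E" for e
      using positive_sqrt_eigenvector[OF Q, of e "norm (K e)"] pos[OF that] Pe[OF that] ev[OF that]
      by (simp add: QQ')
    show "Q x = P x" if "\<And>e. e \<in> E \<Longrightarrow> cinner x e = 0" for x
      using positive_sqrt_kernel[OF Q, of x] Pker[OF that] ker[OF that]
      by (simp add: QQ' bounded_clinear_zero T)
  qed
  ultimately have "modulus_op K = P"
    unfolding modulus_op_def using Ppos by (intro the_equality) blast+
  then have "singular_basis K E"
    by unfold_locales (use K E pos ev ker Ppos Pe Pker in auto)
  then show ?thesis ..
qed

section \<open>Singular values\<close>

lemma corthonormal_inj_on: "corthonormal u I \<Longrightarrow> inj_on u I"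
  by (rule inj_onI) (metis corthonormalD zero_neq_one)

lemma corthonormal_independent:
  assumes "corthonormal u I"
  shows "complex_vector.independent (u ` I)"
  unfolding complex_vector.independent_explicit_finite_subsets
proof (intro allI impI ballI)
  fix S c v
  assume S: "S \<subseteq> u ` I" "finite S" and sum: "(\<Sum>v\<in>S. c v *\<^sub>C v) = 0" and v: "v \<in> S"
  have "corthonormal (\<lambda>x. x) S"
    unfolding corthonormal_def
  proof (intro ballI)
    fix x y assume "x \<in> S" "y \<in> S"
    then obtain i j where "i \<in> I" "x = u i" "j \<in> I" "y = u j" using S(1) by blast
    then show "cinner x y = (if x = y then 1 else 0)"
      using corthonormalD[OF assms, of i j] corthonormalD[OF assms, of i i] by auto
  qed
  from cinner_corthonormal_sum[OF this S(2) order_refl v, of c] show "c v = 0"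
    using sum v by simp
qed

lemma subspace_eigenspace: "bounded_clinear T \<Longrightarrow> complex_vector.subspace (eigenspace T z)"
  unfolding eigenspace_def
  by (rule complex_vector.subspaceI)
    (simp_all add: bounded_clinear_zero bounded_clinear_add bounded_clinear_scaleC
      scaleC_add_right scaleC_scaleC mult.commute)

context singular_basis
begin

lemma bounded: "bounded_clinear K"
  by (rule compact_operator_bounded_clinear[OF compact])

lemma modulus_bounded: "bounded_clinear (modulus_op K)"
  using positive_modulus by (simp add: positive_op_def)

lemma cinner_image:
  assumes "e \<in> E" "f \<in> E"
  shows "cinner (K e) (K f) = (if e = f then complex_of_real ((norm (K e))\<^sup>2) else 0)"
proof -
  have "cinner (K e) (K f) = cinner (adjoint_op K (K e)) f"
    by (simp add: cinner_adjoint_comp[OF bounded])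
  also have "\<dots> = complex_of_real ((norm (K e))\<^sup>2) * cinner e f"
    by (simp add: adjoint_eigen[OF assms(1)] cinner_scaleC_left)
  finally show ?thesis
    using corthonormalD[OF orthonormal assms] by simp
qed

text \<open>The images of distinct basis vectors are orthogonal, hence at distance at least \<open>t\<close> if their
  norms are at least \<open>t\<close>, whereas their closure is compact.\<close>

lemma finite_large:
  assumes t: "t > 0"
  shows "finite {e \<in> E. t \<le> norm (K e)}"
proof (rule ccontr)
  assume "infinite {e \<in> E. t \<le> norm (K e)}"
  then obtain f :: "nat \<Rightarrow> 'a" where inj: "inj f" and f: "range f \<subseteq> {e \<in> E. t \<le> norm (K e)}"
    using infinite_countable_subset by blast
  have fE: "f n \<in> E" and ft: "t \<le> norm (K (f n))" for n
    using f by auto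
  have "norm (f n) \<le> 1" for n
    using corthonormal_norm[OF orthonormal fE] by simp
  then obtain l r where r: "strict_mono r" and l: "(\<lambda>n. K (f (r n))) \<longlonglongrightarrow> l"
    by (rule compact_operator_subseq[OF compact])
  have "Cauchy (\<lambda>n. K (f (r n)))"
    using l by (intro convergent_Cauchy convergentI)
  then obtain N where N: "\<And>m n. m \<ge> N \<Longrightarrow> n \<ge> N \<Longrightarrow> dist (K (f (r m))) (K (f (r n))) < t"
    using t unfolding Cauchy_def by blast
  define a b where "a = f (r N)" and "b = f (r (Suc N))"
  have "r N < r (Suc N)" using r by (simp add: strict_mono_Suc_iff)
  then have "a \<noteq> b" using inj unfolding a_def b_def by (metis injD less_irrefl)
  have ab: "a \<in> E" "b \<in> E" "t \<le> norm (K a)" unfolding a_def b_def using fE ft by auto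
  have "cinner (K a - K b) (K a - K b) = complex_of_real ((norm (K a))\<^sup>2 + (norm (K b))\<^sup>2)"
    using cinner_image[OF ab(1,2)] cinner_image[OF ab(2,1)] cinner_image[OF ab(1,1)]
      cinner_image[OF ab(2,2)] \<open>a \<noteq> b\<close>
    by (simp add: cinner_diff_left cinner_diff_right)
  then have "(norm (K a - K b))\<^sup>2 = (norm (K a))\<^sup>2 + (norm (K b))\<^sup>2"
    unfolding cinner_self of_real_eq_iff .
  then have "(norm (K a))\<^sup>2 \<le> (norm (K a - K b))\<^sup>2"
    by (metis le_add_same_cancel1 zero_le_power2)
  then have "norm (K a) \<le> norm (K a - K b)"
    by (rule power2_le_imp_le[OF _ norm_ge_zero])
  with ab(3) N[of N "Suc N"] show False
    by (simp add: a_def b_def dist_norm)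
qed

text \<open>Subtract from an eigenvector its projection onto the span. The rest is orthogonal to the
  remaining \<open>e\<close> because eigenvectors of a self-adjoint operator for different
  eigenvalues are orthogonal. The modulus thus kills the rest but also multiplies it by
  \<open>t > 0\<close>.\<close>

lemma eigenspace_modulus:
  assumes t: "t > 0"
  shows "eigenspace (modulus_op K) (complex_of_real t)
    = complex_vector.span {e \<in> E. norm (K e) = t}" (is "?L = complex_vector.span ?S")
proof
  have sub: "complex_vector.subspace ?L" by (rule subspace_eigenspace[OF modulus_bounded])
  have S: "?S \<subseteq> ?L" by (auto simp: eigenspace_def modulus_eigen)
  then show "complex_vector.span ?S \<subseteq> ?L" by (rule complex_vector.span_minimal[OF _ sub])
  have fin: "finite ?S" by (rule finite_subset[OF _ finite_large[OF t]]) auto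
  show "?L \<subseteq> complex_vector.span ?S"
  proof
    fix x assume x: "x \<in> ?L"
    define s where "s = (\<Sum>e\<in>?S. cinner x e *\<^sub>C e)"
    have s: "s \<in> complex_vector.span ?S"
      unfolding s_def by (intro complex_vector.span_sum complex_vector.span_scale complex_vector.span_base)
    with \<open>complex_vector.span ?S \<subseteq> ?L\<close> have "x - s \<in> ?L"
      by (intro complex_vector.subspace_diff[OF sub x]) blast
    then have y: "modulus_op K (x - s) = complex_of_real t *\<^sub>C (x - s)"
      by (simp add: eigenspace_def)
    have "cinner (x - s) e = 0" if e: "e \<in> E" for e
    proof (cases "norm (K e) = t")
      case True
      have "cinner s e = cinner x e"
        unfolding s_def using cinner_corthonormal_sum[OF orthonormal fin _ e] True e by simp
      then show ?thesis by (simp add: cinner_diff_left)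
    next
      case False
      have "complex_of_real t * cinner (x - s) e = cinner (modulus_op K (x - s)) e"
        by (simp add: y cinner_scaleC_left)
      also have "\<dots> = complex_of_real (norm (K e)) * cinner (x - s) e"
        by (simp add: positive_op_selfadjoint[OF positive_modulus] modulus_eigen[OF e] cinner_scaleC_right)
      finally show ?thesis using False by simp
    qed
    then have "modulus_op K (x - s) = 0" by (rule modulus_kernel)
    then have "x = s" using y t by simp
    with s show "x \<in> complex_vector.span ?S" by simp
  qed
qed

lemma modulus_eigenvalues_eq: "modulus_eigenvalues K = (\<lambda>e. norm (K e)) ` E"
proof (intro set_eqI iffI)
  fix t assume "t \<in> modulus_eigenvalues K"
  then have t: "t > 0" and "\<exists>x\<in>eigenspace (modulus_op K) (complex_of_real t). x \<noteq> 0"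
    by (auto simp: modulus_eigenvalues_def eigenvalue_def)
  then have "{e \<in> E. norm (K e) = t} \<noteq> {}"
    unfolding eigenspace_modulus[OF t] by (metis complex_vector.span_empty singletonD)
  then show "t \<in> (\<lambda>e. norm (K e)) ` E" by auto
next
  fix t assume "t \<in> (\<lambda>e. norm (K e)) ` E"
  then obtain e where e: "e \<in> E" "t = norm (K e)" by blast
  have "e \<noteq> 0" using corthonormal_norm[OF orthonormal e(1)] by auto
  with e norm_pos[OF e(1)] modulus_eigen[OF e(1)] show "t \<in> modulus_eigenvalues K"
    unfolding modulus_eigenvalues_def eigenvalue_def eigenspace_def by auto
qed

lemma modulus_mult_eq: "t > 0 \<Longrightarrow> modulus_mult K t = card {e \<in> E. norm (K e) = t}"
proof -
  assume t: "t > 0"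
  have "complex_vector.independent {e \<in> E. norm (K e) = t}"
    using corthonormal_independent[OF corthonormal_subset[OF orthonormal], of "{e \<in> E. norm (K e) = t}"]
    by auto
  then show ?thesis
    unfolding modulus_mult_def eigenspace_modulus[OF t] complex_vector.dim_span
    by (rule complex_vector.dim_eq_card_independent)
qed

text \<open>Grouping basis vectors by the norm of their image turns the multiplicity sum inside
  \<open>singular_value\<close> into a cardinality, finite because \<open>t > 0\<close>.\<close>

lemma counting_function:
  assumes t: "t > 0"
  shows "(\<Sum>u\<in>{u \<in> modulus_eigenvalues K. t \<le> u}. modulus_mult K u) = card {e \<in> E. t \<le> norm (K e)}"
proof -
  let ?S = "{e \<in> E. t \<le> norm (K e)}" and ?g = "\<lambda>e. norm (K e)"
  have img: "{u \<in> modulus_eigenvalues K. t \<le> u} = ?g ` ?S"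
    by (auto simp: modulus_eigenvalues_eq)
  have "card ?S = (\<Sum>u\<in>?g ` ?S. \<Sum>e\<in>{e. e \<in> ?S \<and> ?g e = u}. 1)"
    unfolding card_eq_sum by (rule sum.image_gen[OF finite_large[OF t]])
  also have "\<dots> = (\<Sum>u\<in>?g ` ?S. modulus_mult K u)"
  proof (rule sum.cong[OF refl])
    fix u assume "u \<in> ?g ` ?S"
    then have "u \<ge> t" by auto
    then have "{e. e \<in> ?S \<and> ?g e = u} = {e \<in> E. ?g e = u}" by auto
    then show "(\<Sum>e\<in>{e. e \<in> ?S \<and> ?g e = u}. 1) = modulus_mult K u"
      using modulus_mult_eq[of u] \<open>u \<ge> t\<close> t by simp
  qed
  finally show ?thesis unfolding img ..
qed

text \<open>\<open>norm (K e)\<close> is a member of the set whose supremum is taken. Singular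
  values stand on the larger side of the final estimate, so lower bounds suffice.\<close>

lemma singular_value_ge:
  assumes e: "e \<in> E" and n: "n < card {f \<in> E. norm (K e) \<le> norm (K f)}"
  shows "norm (K e) \<le> singular_value K n"
proof -
  obtain C where C: "C > 0" "\<And>x. norm (K x) \<le> C * norm x" using bounded_clinear_bound[OF bounded] by blast
  show ?thesis
    unfolding singular_value_def
  proof (rule cSup_upper)
    show "norm (K e) \<in> insert 0 {t \<in> modulus_eigenvalues K.
        n < (\<Sum>u\<in>{u \<in> modulus_eigenvalues K. t \<le> u}. modulus_mult K u)}"
      using n counting_function[OF norm_pos[OF e]] e by (simp add: modulus_eigenvalues_eq)
    show "bdd_above (insert 0 {t \<in> modulus_eigenvalues K.
        n < (\<Sum>u\<in>{u \<in> modulus_eigenvalues K. t \<le> u}. modulus_mult K u)})"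
    proof (rule bdd_aboveI)
      fix t assume "t \<in> insert 0 {t \<in> modulus_eigenvalues K.
        n < (\<Sum>u\<in>{u \<in> modulus_eigenvalues K. t \<le> u}. modulus_mult K u)}"
      then show "t \<le> C"
        using C corthonormal_norm[OF orthonormal] unfolding modulus_eigenvalues_eq
        by (auto, metis mult.right_neutral)
    qed
  qed
qed

text \<open>Induction removing a vector with the smallest image norm, which is matched with the last
  of the first \<open>card F\<close> singular values.\<close>

lemma sum_powr_le_singular_values:
  assumes "finite F" "F \<subseteq> E" and p: "p \<ge> 0"
  shows "(\<Sum>e\<in>F. norm (K e) powr p) \<le> (\<Sum>n<card F. singular_value K n powr p)"
  using assms(1,2)
proof (induction "card F" arbitrary: F)
  case (Suc m)
  then have "F \<noteq> {}" by auto
  then obtain f where f: "f \<in> F" "\<And>e. e \<in> F \<Longrightarrow> norm (K f) \<le> norm (K e)"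
    using ex_is_arg_min_if_finite[OF Suc.prems(1), of "\<lambda>e. norm (K e)"]
    by (auto simp: is_arg_min_linorder)
  have m: "card (F - {f}) = m" using Suc.hyps(2) f(1) by (simp add: card_Diff_singleton)
  \<comment> \<open>All \<open>Suc m\<close> vectors of \<open>F\<close> count towards the level
    \<open>norm (K f)\<close>; as indices start at 0, the bound applies at index
    \<open>m\<close>.\<close>
  have "card F \<le> card {e \<in> E. norm (K f) \<le> norm (K e)}"
    using f(1) Suc.prems by (intro card_mono finite_large norm_pos) (auto intro: f(2))
  then have "norm (K f) \<le> singular_value K m"
    using Suc.hyps(2) Suc.prems(2) f(1) by (intro singular_value_ge) auto
  then have "norm (K f) powr p \<le> singular_value K m powr p"
    using p by (intro powr_mono2) auto
  moreover have "(\<Sum>e\<in>F - {f}. norm (K e) powr p) \<le> (\<Sum>n<m. singular_value K n powr p)"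
    using Suc.hyps(1)[OF m[symmetric]] Suc.prems m by auto
  ultimately show ?case
    using Suc.prems(1) f(1) Suc.hyps(2)[symmetric] by (simp add: sum.remove[of F f])
qed simp

end

section \<open>The Schatten norm dominates diagonal entries\<close>

text \<open>Jensen's inequality for weights of total mass \<open>W \<le> 1\<close>: normalize by
  \<open>W\<close>, then absorb the factor \<open>W powr p\<close> into \<open>W\<close>.\<close>

lemma powr_weighted_sum_le:
  fixes w s :: "'i \<Rightarrow> real"
  assumes F: "finite F" and w: "\<And>i. i \<in> F \<Longrightarrow> w i \<ge> 0" "sum w F \<le> 1"
    and s: "\<And>i. i \<in> F \<Longrightarrow> s i > 0" and p: "p \<ge> 1"
  shows "(\<Sum>i\<in>F. w i * s i) powr p \<le> (\<Sum>i\<in>F. w i * s i powr p)"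
proof (cases "sum w F = 0")
  case True
  then have "w i = 0" if "i \<in> F" for i
    using sum_nonneg_eq_0_iff[OF F, of w] w(1) that by auto
  then show ?thesis by simp
next
  case False
  define W where "W = sum w F"
  have W: "W > 0" "W \<le> 1" using False w sum_nonneg[of F w] by (auto simp: W_def)
  have "F \<noteq> {}" using False by auto
  have scale: "(\<Sum>i\<in>F. w i * g i) = W * (\<Sum>i\<in>F. w i / W * g i)" for g :: "'i \<Rightarrow> real"
    unfolding sum_distrib_left using W by (intro sum.cong) auto
  have nonneg: "0 \<le> (\<Sum>i\<in>F. w i / W * s i)"
    using W w(1) s by (intro sum_nonneg mult_nonneg_nonneg) (auto intro: less_imp_le)
  have "(\<Sum>i\<in>F. w i * s i) powr p = W powr p * (\<Sum>i\<in>F. w i / W * s i) powr p"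
    unfolding scale[of s] by (rule powr_mult)
  also have "\<dots> \<le> W * (\<Sum>i\<in>F. w i / W * s i powr p)"
  proof (rule mult_mono)
    show "W powr p \<le> W"
      using powr_mono'[of 1 p W] W p by simp
    have "(\<Sum>i\<in>F. (w i / W) *\<^sub>R s i) powr p \<le> (\<Sum>i\<in>F. w i / W * s i powr p)"
      by (rule convex_on_sum[OF F \<open>F \<noteq> {}\<close> powr_convex[OF p]])
        (use W w s in \<open>auto simp: W_def simp flip: sum_divide_distrib\<close>)
    then show "(\<Sum>i\<in>F. w i / W * s i) powr p \<le> (\<Sum>i\<in>F. w i / W * s i powr p)" by simp
  qed (use W in auto)
  also have "\<dots> = (\<Sum>i\<in>F. w i * s i powr p)"
    by (rule scale[symmetric])
  finally show ?thesis .
qed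

lemma sum_le_one_if_le_mean:
  fixes g b c :: "'i \<Rightarrow> real"
  assumes "\<And>i. i \<in> S \<Longrightarrow> g i \<le> (b i + c i) / 2" "sum b S \<le> 1" "sum c S \<le> 1"
  shows "sum g S \<le> 1"
proof -
  have "sum g S \<le> (\<Sum>i\<in>S. (b i + c i) / 2)" by (rule sum_mono) (rule assms)
  also have "\<dots> = (sum b S + sum c S) / 2" by (simp add: sum.distrib flip: sum_divide_distrib)
  finally show ?thesis using assms by simp
qed

text \<open>The partial sums of \<open>\<langle>K u\<^sub>j, u\<^sub>j\<rangle> = \<Sum>\<^sub>e \<langle>u\<^sub>j, e\<rangle> \<langle>K e, u\<^sub>j\<rangle>\<close> are bounded by \<open>\<Sum>\<^sub>e w\<^sub>j\<^sub>e \<parallel>K e\<parallel>\<close> with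
  weights \<open>w\<^sub>j\<^sub>e\<close> whose row and column sums are at most \<open>1\<close> by Bessel's inequality.\<close>

lemma (in singular_basis) sum_diagonal_powr_le:
  assumes u: "corthonormal u J" "finite J" and p: "p \<ge> 1"
    and summ: "summable (\<lambda>n. singular_value K n powr p)"
  shows "(\<Sum>j\<in>J. cmod (cinner (K (u j)) (u j)) powr p) \<le> (\<Sum>n. singular_value K n powr p)"
proof -
  define a where "a j F = (\<Sum>e\<in>F. cinner (u j) e * cinner (K e) (u j))" for j and F :: "'a set"
  \<comment> \<open>The left singular vectors; their orthonormality makes Bessel's inequality
    available for the second factor of the weights as well.\<close>
  define v where "v e = complex_of_real (1 / norm (K e)) *\<^sub>C K e" for e
  have v: "corthonormal v E"
    unfolding corthonormal_def v_def
    using norm_pos by (simp add: cinner_scaleC_left cinner_scaleC_right cinner_image power2_eq_square)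
  have lim: "(a j \<longlongrightarrow> cinner (K (u j)) (u j)) (finite_subsets_at_top E)" for j
  proof -
    obtain s where s: "((\<lambda>e. cinner (u j) e *\<^sub>C e) has_sum s) E"
      and perp: "\<And>e. e \<in> E \<Longrightarrow> cinner (u j - s) e = 0"
      using corthonormal_expansion[OF orthonormal] by blast
    \<comment> \<open>The part of \<open>u j\<close> orthogonal to \<open>E\<close> lies in the
      kernel of \<open>K\<close>, so expanding over \<open>E\<close> loses nothing.\<close>
    have "K (u j) = K s"
      using kernel[OF perp] by (simp add: bounded_clinear_diff[OF bounded])
    moreover have "bounded_linear (\<lambda>x. cinner (K x) (u j))"
      by (rule bounded_linear_compose[OF bounded_linear_cinner_left bounded_clinear_bounded_linear[OF bounded]])
    from has_sum_bounded_linear[OF this s] have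
      "((\<lambda>e. cinner (u j) e * cinner (K e) (u j)) has_sum cinner (K s) (u j)) E"
      by (simp add: bounded_clinear_scaleC[OF bounded] cinner_scaleC_left)
    ultimately show ?thesis unfolding has_sum_def a_def by simp
  qed
  have bound: "(\<Sum>j\<in>J. cmod (a j F) powr p) \<le> (\<Sum>n. singular_value K n powr p)"
    if F: "finite F" "F \<subseteq> E" for F
  proof -
    define w where "w j e = cmod (cinner (u j) e) * cmod (cinner (u j) (v e))" for j e
    have w_le: "w j e \<le> ((cmod (cinner (u j) e))\<^sup>2 + (cmod (cinner (u j) (v e)))\<^sup>2) / 2" for j e
      using sum_squares_bound[of "cmod (cinner (u j) e)" "cmod (cinner (u j) (v e))"]
      by (simp add: w_def)
    have row: "(\<Sum>e\<in>F. w j e) \<le> 1" if j: "j \<in> J" for j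
      using bessel_finite[OF corthonormal_subset[OF orthonormal F(2)] F(1), of "u j"]
        bessel_finite[OF corthonormal_subset[OF v F(2)] F(1), of "u j"] corthonormal_norm[OF u(1) j]
      by (intro sum_le_one_if_le_mean[OF w_le]) auto
    have col: "(\<Sum>j\<in>J. w j e) \<le> 1" if e: "e \<in> F" for e
      using bessel_finite[OF u, of e] bessel_finite[OF u, of "v e"]
        corthonormal_norm[OF orthonormal, of e] corthonormal_norm[OF v, of e] e F(2)
      by (intro sum_le_one_if_le_mean[OF w_le]) (auto simp: cmod_cinner_commute[of "u _"])
    have a_le: "cmod (a j F) \<le> (\<Sum>e\<in>F. w j e * norm (K e))" for j
      unfolding a_def
    proof (rule sum_norm_le)
      fix e assume "e \<in> F"
      then have "norm (K e) > 0" using F(2) norm_pos by auto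
      then have "cmod (cinner (u j) (v e)) * norm (K e) = cmod (cinner (K e) (u j))"
        by (simp add: v_def cinner_scaleC_right norm_mult norm_divide cmod_cinner_commute[of "u j"])
      then show "cmod (cinner (u j) e * cinner (K e) (u j)) \<le> w j e * norm (K e)"
        by (simp add: w_def norm_mult mult.assoc)
    qed
    have "(\<Sum>j\<in>J. cmod (a j F) powr p) \<le> (\<Sum>j\<in>J. \<Sum>e\<in>F. w j e * norm (K e) powr p)"
    proof (rule sum_mono)
      fix j assume j: "j \<in> J"
      have "cmod (a j F) powr p \<le> (\<Sum>e\<in>F. w j e * norm (K e)) powr p"
        using a_le p by (intro powr_mono2) auto
      also have "\<dots> \<le> (\<Sum>e\<in>F. w j e * norm (K e) powr p)"
        using F row[OF j] p by (intro powr_weighted_sum_le norm_pos) (auto simp: w_def)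
      finally show "cmod (a j F) powr p \<le> (\<Sum>e\<in>F. w j e * norm (K e) powr p)" .
    qed
    \<comment> \<open>Row sums at most 1 justified Jensen for each \<open>j\<close>; after the
      interchange, column sums at most 1 remove the weights.\<close>
    also have "\<dots> = (\<Sum>e\<in>F. (\<Sum>j\<in>J. w j e) * norm (K e) powr p)"
      unfolding sum_distrib_right by (rule sum.swap)
    also have "\<dots> \<le> (\<Sum>e\<in>F. norm (K e) powr p)"
      using col by (intro sum_mono mult_left_le_one_le sum_nonneg) (auto simp: w_def)
    also have "\<dots> \<le> (\<Sum>n<card F. singular_value K n powr p)"
      using F p by (intro sum_powr_le_singular_values) auto
    also have "\<dots> \<le> (\<Sum>n. singular_value K n powr p)"
      using summ by (intro sum_le_suminf) auto
    finally show ?thesis .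
  qed
  have "((\<lambda>F. \<Sum>j\<in>J. cmod (a j F) powr p) \<longlongrightarrow> (\<Sum>j\<in>J. cmod (cinner (K (u j)) (u j)) powr p))
      (finite_subsets_at_top E)"
    using p by (intro tendsto_sum tendsto_powr' tendsto_norm lim tendsto_const) auto
  then show ?thesis
    by (rule tendsto_upperbound)
      (auto intro!: eventually_finite_subsets_at_top_weakI bound)
qed

section \<open>Triangular bases of root spaces\<close>

lemma bounded_clinear_shift:
  assumes "bounded_clinear B"
  shows "bounded_clinear (\<lambda>y. B y - z *\<^sub>C y)"
  unfolding bounded_clinear_def
proof (intro conjI allI)
  show "bounded_linear (\<lambda>y. B y - z *\<^sub>C y)"
    by (intro bounded_linear_sub bounded_linear_scaleC bounded_clinear_bounded_linear[OF assms])
  show "B (c *\<^sub>C x) - z *\<^sub>C c *\<^sub>C x = c *\<^sub>C (B x - z *\<^sub>C x)" for c x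
    by (simp add: bounded_clinear_scaleC[OF assms] complex_vector.scale_right_diff_distrib
        scaleC_scaleC mult.commute)
qed

lemma bounded_clinear_funpow: "bounded_clinear T \<Longrightarrow> bounded_clinear (T ^^ k)"
proof (induction k)
  case 0
  show ?case by (simp add: bounded_clinear_def bounded_linear_ident id_def)
next
  case (Suc k)
  then show ?case
    unfolding funpow.simps by (intro bounded_clinear_comp)
qed

lemma funpow_commute: "(T ^^ j) ((T ^^ k) x) = (T ^^ k) ((T ^^ j) x)"
  by (metis add.commute comp_apply funpow_add)

lemma subspace_root_space:
  assumes "bounded_clinear B"
  shows "complex_vector.subspace (root_space B z)"
proof -
  define N where "N y = B y - z *\<^sub>C y" for y
  have "bounded_clinear (N ^^ k)" for k
    using bounded_clinear_funpow[OF bounded_clinear_shift[OF assms]] by (simp add: N_def[abs_def])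
  note [simp] = bounded_clinear_zero[OF this] bounded_clinear_add[OF this] bounded_clinear_scaleC[OF this]
  have R: "root_space B z = {x. \<exists>k. (N ^^ k) x = 0}"
    by (simp add: root_space_def N_def[abs_def])
  show ?thesis
    unfolding R
  proof (rule complex_vector.subspaceI)
    fix x y assume "x \<in> {x. \<exists>k. (N ^^ k) x = 0}" "y \<in> {x. \<exists>k. (N ^^ k) x = 0}"
    then obtain j k where "(N ^^ j) x = 0" "(N ^^ k) y = 0" by blast
    then have "(N ^^ (j + k)) (x + y) = 0"
      by (simp add: funpow_add funpow_commute[of j N k x])
    then show "x + y \<in> {x. \<exists>k. (N ^^ k) x = 0}" by blast
  qed auto
qed

lemma root_space_funpow:
  assumes "bounded_clinear B" "x \<in> root_space B z"
  shows "((\<lambda>y. B y - z *\<^sub>C y) ^^ k) x \<in> root_space B z"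
proof -
  define N where "N y = B y - z *\<^sub>C y" for y
  obtain m where "(N ^^ m) x = 0" using assms(2) by (auto simp: root_space_def N_def[abs_def])
  then have "(N ^^ m) ((N ^^ k) x) = 0"
    using bounded_clinear_zero[OF bounded_clinear_funpow[OF bounded_clinear_shift[OF assms(1)]]]
    by (simp add: funpow_commute[of m] N_def[abs_def])
  then show ?thesis by (auto simp: root_space_def N_def[abs_def])
qed

section \<open>Orthonormal flags and upper triangular form\<close>

lemma cinner_span_eq_0:
  assumes "y \<in> complex_vector.span S" "\<And>s. s \<in> S \<Longrightarrow> cinner s x = 0"
  shows "cinner y x = 0"
proof -
  have "complex_vector.subspace {y. cinner y x = 0}"
    by (rule complex_vector.subspaceI) (auto simp: cinner_add_left cinner_scaleC_left)
  then have "complex_vector.span S \<subseteq> {y. cinner y x = 0}"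
    using assms(2) by (intro complex_vector.span_minimal) auto
  with assms(1) show ?thesis by blast
qed

lemma corthonormal_cinner_span:
  fixes e :: "nat \<Rightarrow> 'a::complex_inner"
  assumes e: "corthonormal e {..<n}" and "i \<le> k" "k < n"
    and y: "y \<in> complex_vector.span (e ` {..<i})"
  shows "cinner y (e k) = 0"
proof (rule cinner_span_eq_0[OF y])
  fix s assume "s \<in> e ` {..<i}"
  then obtain j where "j < i" "s = e j" by blast
  moreover have "j < n" "j \<noteq> k" using \<open>j < i\<close> assms(2,3) by auto
  ultimately show "cinner s (e k) = 0"
    using corthonormalD[OF e, of j k] assms(3) by simp
qed

text \<open>Schur form: on the span of the first \<open>n\<close> vectors the matrix of
  \<open>B\<close> is upper triangular with diagonal \<open>w\<close>. Values beyond
  \<open>n\<close> are unconstrained, so a basis is extended by function update.\<close>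

definition triangular :: "('a::complex_inner \<Rightarrow> 'a) \<Rightarrow> (nat \<Rightarrow> 'a) \<Rightarrow> (nat \<Rightarrow> complex) \<Rightarrow> nat \<Rightarrow> bool" where
  "triangular B e w n \<longleftrightarrow> corthonormal e {..<n} \<and>
    (\<forall>i<n. B (e i) - w i *\<^sub>C e i \<in> complex_vector.span (e ` {..<i}))"

lemma triangular_diagonal:
  assumes "triangular B e w n" "i < n"
  shows "cinner (B (e i)) (e i) = w i"
proof -
  have e: "corthonormal e {..<n}" and "B (e i) - w i *\<^sub>C e i \<in> complex_vector.span (e ` {..<i})"
    using assms by (auto simp: triangular_def)
  from corthonormal_cinner_span[OF e order_refl assms(2) this(2)] show ?thesis
    using corthonormalD[OF e, of i i] assms(2) by (simp add: cinner_diff_left cinner_scaleC_left)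
qed

lemma triangular_invariant:
  assumes B: "bounded_clinear B" and tri: "triangular B e w n"
    and x: "x \<in> complex_vector.span (e ` {..<n})"
  shows "B x \<in> complex_vector.span (e ` {..<n})"
proof -
  let ?W = "complex_vector.span (e ` {..<n})"
  have "complex_vector.subspace {x. B x \<in> ?W}"
    by (rule complex_vector.subspaceI)
      (auto simp: bounded_clinear_zero[OF B] bounded_clinear_add[OF B] bounded_clinear_scaleC[OF B]
        complex_vector.span_zero intro: complex_vector.span_add complex_vector.span_scale)
  moreover have "B (e i) \<in> ?W" if i: "i < n" for i
  proof -
    have "B (e i) - w i *\<^sub>C e i \<in> ?W"
      using tri i complex_vector.span_mono[of "e ` {..<i}" "e ` {..<n}"]
      unfolding triangular_def by fastforce
    then have "(B (e i) - w i *\<^sub>C e i) + w i *\<^sub>C e i \<in> ?W"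
      by (rule complex_vector.span_add) (use i in \<open>auto intro: complex_vector.span_scale complex_vector.span_base\<close>)
    then show ?thesis by simp
  qed
  ultimately have "?W \<subseteq> {x. B x \<in> ?W}"
    by (intro complex_vector.span_minimal) auto
  with x show ?thesis by blast
qed

lemma triangular_Suc: "triangular B e w (Suc n) \<Longrightarrow> triangular B e w n"
  by (auto simp: triangular_def corthonormal_def)

text \<open>If \<open>w\<^sub>n \<noteq> z\<close>, then \<open>B - z\<close> acts invertibly on the quotient of the \<open>(n+1)\<close>-st space of the flag
  by the \<open>n\<close>-th, so the root space gains nothing from \<open>e\<^sub>n\<close>; otherwise it gains at most one dimension.\<close>

lemma root_space_triangular:
  assumes B: "bounded_clinear B" and "triangular B e w n"
  shows "\<exists>S. finite S \<and> card S \<le> card {i. i < n \<and> w i = z} \<and>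
    root_space B z \<inter> complex_vector.span (e ` {..<n}) \<subseteq> complex_vector.span S"
  using assms(2)
proof (induction n)
  case 0
  then show ?case by (intro exI[of _ "{}"]) auto
next
  case (Suc n)
  let ?W = "complex_vector.span (e ` {..<n})" and ?W' = "complex_vector.span (e ` {..<Suc n})"
  let ?R = "root_space B z"
  note tri = triangular_Suc[OF Suc.prems]
  obtain S where S: "finite S" "card S \<le> card {i. i < n \<and> w i = z}"
    "?R \<inter> ?W \<subseteq> complex_vector.span S"
    using Suc.IH[OF tri] by blast
  have W': "x \<in> ?W' \<longleftrightarrow> (\<exists>c. x - c *\<^sub>C e n \<in> ?W)" for x
    by (simp add: lessThan_Suc complex_vector.span_breakdown_eq)
  have W_sub: "complex_vector.subspace ?W" by (rule complex_vector.subspace_span)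
  show ?case
  proof (cases "?R \<inter> ?W' \<subseteq> ?W")
    case True
    have "card {i. i < n \<and> w i = z} \<le> card {i. i < Suc n \<and> w i = z}"
      by (intro card_mono) auto
    with S True show ?thesis by (intro exI[of _ S]) auto
  next
    case False
    then obtain x c where x: "x \<in> ?R" "x - c *\<^sub>C e n \<in> ?W" "x \<notin> ?W"
      using W' by blast
    have "c \<noteq> 0" using x(2,3) by auto
    define N where "N y = B y - z *\<^sub>C y" for y
    have N: "bounded_clinear N" using bounded_clinear_shift[OF B] by (simp add: N_def[abs_def])
    have N_inv: "N y \<in> ?W" if "y \<in> ?W" for y
      unfolding N_def using that triangular_invariant[OF B tri that]
      by (intro complex_vector.span_diff complex_vector.span_scale)
    have N_e: "N (e n) - (w n - z) *\<^sub>C e n \<in> ?W"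
      using Suc.prems by (simp add: triangular_def N_def complex_vector.scale_left_diff_distrib)
    \<comment> \<open>Modulo \<open>?W\<close>, \<open>N\<close> multiplies \<open>e n\<close> by
      \<open>w n - z\<close>. Some power of \<open>N\<close> annihilates \<open>x\<close>, and the
      \<open>e n\<close> component of \<open>x\<close> is nonzero, so \<open>w n - z\<close> must
      vanish.\<close>
    have pow: "(N ^^ k) x - (c * (w n - z) ^ k) *\<^sub>C e n \<in> ?W" for k
    proof (induction k)
      case (Suc k)
      let ?d = "c * (w n - z) ^ k"
      have "N ((N ^^ k) x - ?d *\<^sub>C e n) + ?d *\<^sub>C (N (e n) - (w n - z) *\<^sub>C e n) \<in> ?W"
        using N_inv[OF Suc.IH] N_e by (intro complex_vector.span_add complex_vector.span_scale)
      then show ?case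
        by (simp add: bounded_clinear_diff[OF N] bounded_clinear_scaleC[OF N]
            complex_vector.scale_right_diff_distrib scaleC_scaleC mult_ac)
    qed (simp add: x(2))
    obtain k where "(N ^^ k) x = 0" using x(1) by (auto simp: root_space_def N_def[abs_def])
    with pow[of k] have "- ((c * (w n - z) ^ k) *\<^sub>C e n) \<in> ?W" by simp
    moreover have "corthonormal e {..<Suc n}" using Suc.prems by (simp add: triangular_def)
    ultimately have "cinner (- ((c * (w n - z) ^ k) *\<^sub>C e n)) (e n) = 0"
      using corthonormal_cinner_span[of e "Suc n" n n] by blast
    then have "c * (w n - z) ^ k = 0"
      using corthonormalD[OF \<open>corthonormal e {..<Suc n}\<close>, of n n]
      by (simp add: cinner_minus_left cinner_scaleC_left)
    with \<open>c \<noteq> 0\<close> have "w n = z" by simp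
    then have "{i. i < Suc n \<and> w i = z} = insert n {i. i < n \<and> w i = z}" by auto
    then have "card {i. i < Suc n \<and> w i = z} = Suc (card {i. i < n \<and> w i = z})" by simp
    moreover have "card (insert x S) \<le> Suc (card S)"
      using S(1) by (simp add: card_insert_if)
    ultimately have card: "card (insert x S) \<le> card {i. i < Suc n \<and> w i = z}"
      using S(2) by simp
    have "y \<in> complex_vector.span (insert x S)" if y: "y \<in> ?R" "y \<in> ?W'" for y
    proof -
      obtain d where d: "y - d *\<^sub>C e n \<in> ?W" using W' y(2) by blast
      \<comment> \<open>The multiple \<open>d / c\<close> of \<open>x\<close> cancels the
        \<open>e n\<close> component of \<open>y\<close>, leaving a root vector in
        \<open>?W\<close>.\<close>
      have "(y - d *\<^sub>C e n) - (d / c) *\<^sub>C (x - c *\<^sub>C e n) \<in> ?W"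
        by (rule complex_vector.span_diff[OF d complex_vector.span_scale[OF x(2)]])
      then have "y - (d / c) *\<^sub>C x \<in> ?W"
        using \<open>c \<noteq> 0\<close> by (simp add: complex_vector.scale_right_diff_distrib scaleC_scaleC)
      moreover have "y - (d / c) *\<^sub>C x \<in> ?R"
        using y(1) x(1) subspace_root_space[OF B]
        by (intro complex_vector.subspace_diff complex_vector.subspace_scale)
      ultimately have "y - (d / c) *\<^sub>C x \<in> complex_vector.span S" using S(3) by blast
      then show ?thesis unfolding complex_vector.span_breakdown_eq ..
    qed
    with S(1) card show ?thesis by (intro exI[of _ "insert x S"]) auto
  qed
qed

text \<open>One Gram-Schmidt step for an eigenvector modulo the flag: correcting \<open>y\<close> by
  its projection is harmless because the flag is invariant under \<open>B - z\<close>. The location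
  of \<open>v\<close> keeps the construction inside a fixed finite-dimensional space.\<close>

lemma triangular_extend:
  assumes B: "bounded_clinear B" and tri: "triangular B e w n"
    and y: "y \<notin> complex_vector.span (e ` {..<n})"
      "B y - z *\<^sub>C y \<in> complex_vector.span (e ` {..<n})"
  obtains v where "triangular B (e(n := v)) (w(n := z)) (Suc n)"
    and "v \<in> complex_vector.span (insert y (e ` {..<n}))"
proof -
  let ?W = "complex_vector.span (e ` {..<n})"
  have e: "corthonormal e {..<n}" using tri by (simp add: triangular_def)
  define s where "s = (\<Sum>i<n. cinner y (e i) *\<^sub>C e i)"
  have s: "s \<in> ?W"
    unfolding s_def
    by (intro complex_vector.span_sum complex_vector.span_scale complex_vector.span_base) auto
  define c where "c = complex_of_real (1 / norm (y - s))"
  define v where "v = c *\<^sub>C (y - s)"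
  have "y \<noteq> s" using s y(1) by auto
  then have norm_v: "norm v = 1"
    unfolding v_def c_def by (intro norm_normalized) auto
  have orth: "cinner v (e i) = 0" if "i < n" for i
    using cinner_corthonormal_sum[OF e _ order_refl, of i] that
    by (simp add: v_def s_def cinner_scaleC_left cinner_diff_left)
  have "B s - z *\<^sub>C s \<in> ?W"
    by (intro complex_vector.span_diff complex_vector.span_scale s triangular_invariant[OF B tri s])
  then have "c *\<^sub>C ((B y - z *\<^sub>C y) - (B s - z *\<^sub>C s)) \<in> ?W"
    by (rule complex_vector.span_scale[OF complex_vector.span_diff[OF y(2)]])
  then have step: "B v - z *\<^sub>C v \<in> ?W"
    by (simp add: v_def bounded_clinear_scaleC[OF B] bounded_clinear_diff[OF B] scaleC_scaleC
        complex_vector.scale_right_diff_distrib algebra_simps)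
  have img: "(e(n := v)) ` {..<i} = e ` {..<i}" if "i \<le> n" for i
    using that by (intro image_cong) auto
  have "cinner ((e(n := v)) i) ((e(n := v)) j) = (if i = j then 1 else 0)" if "i < Suc n" "j < Suc n" for i j
    using that orth[of i] orth[of j] cinner_eq_zero_commute[of v] norm_eq_1_imp_cinner[OF norm_v]
      corthonormalD[OF e, of i j]
    by (cases "i = n"; cases "j = n") auto
  then have "corthonormal (e(n := v)) {..<Suc n}" by (simp add: corthonormal_def)
  moreover have "B ((e(n := v)) i) - (w(n := z)) i *\<^sub>C (e(n := v)) i
      \<in> complex_vector.span ((e(n := v)) ` {..<i})" if "i < Suc n" for i
    using that tri step img[of i] by (cases "i = n") (auto simp: triangular_def simp del: fun_upd_image)
  ultimately have "triangular B (e(n := v)) (w(n := z)) (Suc n)"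
    unfolding triangular_def by blast
  moreover have "?W \<subseteq> complex_vector.span (insert y (e ` {..<n}))"
    by (rule complex_vector.span_mono) auto
  then have "v \<in> complex_vector.span (insert y (e ` {..<n}))"
    unfolding v_def
    using complex_vector.span_scale[OF complex_vector.span_diff[OF complex_vector.span_base[OF insertI1]]] s
    by blast
  ultimately show ?thesis by (rule that)
qed

text \<open>Take a longest triangular system inside a finite-dimensional space containing all the
  root spaces. If a root vector lay outside its span, the iterates of \<open>B - z\<close> would
  eventually enter the span, and the last iterate outside would permit an extension.\<close>

lemma triangular_basis_exists:
  assumes B: "bounded_clinear B" and Z: "finite Z" "\<And>z. z \<in> Z \<Longrightarrow> cfinite_dim (root_space B z)"
  shows "\<exists>e w n. triangular B e w n \<and> (\<forall>z\<in>Z. root_space B z \<subseteq> complex_vector.span (e ` {..<n}))"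
proof -
  obtain D where D: "\<And>z. z \<in> Z \<Longrightarrow> finite (D z)"
    "\<And>z. z \<in> Z \<Longrightarrow> root_space B z \<subseteq> complex_vector.span (D z)"
    using Z(2) unfolding cfinite_dim_def by metis
  define S where "S = (\<Union>z\<in>Z. D z)"
  have "finite S" using Z(1) D(1) by (simp add: S_def)
  have RS: "root_space B z \<subseteq> complex_vector.span S" if "z \<in> Z" for z
    using D(2)[OF that] complex_vector.span_mono[of "D z" S] that by (auto simp: S_def)
  define P where "P n \<longleftrightarrow> (\<exists>e w. triangular B e w n \<and> e ` {..<n} \<subseteq> complex_vector.span S)" for n
  have "P 0" by (simp add: P_def triangular_def corthonormal_def)
  \<comment> \<open>Orthonormal vectors in the span of \<open>S\<close> are independent, which
    bounds the length and makes a maximal \<open>n\<close> available.\<close>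
  moreover have "n \<le> card S" if "P n" for n
  proof -
    obtain e w where e: "triangular B e w n" "e ` {..<n} \<subseteq> complex_vector.span S"
      using \<open>P n\<close> by (auto simp: P_def)
    then have "corthonormal e {..<n}" by (simp add: triangular_def)
    then show ?thesis
      using complex_vector.independent_span_bound[OF \<open>finite S\<close> corthonormal_independent e(2)]
        card_image[OF corthonormal_inj_on] by fastforce
  qed
  ultimately obtain n where "P n" and max: "\<And>m. P m \<Longrightarrow> m \<le> n"
    using GreatestI_nat[of P 0 "card S"] Greatest_le_nat[of P _ "card S"] by metis
  then obtain e w where tri: "triangular B e w n" and eS: "e ` {..<n} \<subseteq> complex_vector.span S"
    by (auto simp: P_def)
  let ?W = "complex_vector.span (e ` {..<n})"
  have "root_space B z \<subseteq> ?W" if z: "z \<in> Z" for z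
  proof
    fix x assume x: "x \<in> root_space B z"
    define N where "N y = B y - z *\<^sub>C y" for y
    show "x \<in> ?W"
    proof (rule ccontr)
      assume "x \<notin> ?W"
      have "\<exists>k. (N ^^ k) x \<in> ?W"
        using x complex_vector.span_zero[of "e ` {..<n}"]
        unfolding root_space_def N_def[abs_def] mem_Collect_eq by metis
      then obtain k where k: "(N ^^ k) x \<in> ?W" "\<And>j. j < k \<Longrightarrow> (N ^^ j) x \<notin> ?W"
        using exists_least_iff[of "\<lambda>k. (N ^^ k) x \<in> ?W"] by blast
      with \<open>x \<notin> ?W\<close> obtain j where "k = Suc j" by (cases k) auto
      define y where "y = (N ^^ j) x"
      have "y \<notin> ?W" using k(2) \<open>k = Suc j\<close> by (simp add: y_def)
      moreover have "B y - z *\<^sub>C y \<in> ?W" using k(1) \<open>k = Suc j\<close> by (simp add: y_def N_def)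
      ultimately obtain v where v: "triangular B (e(n := v)) (w(n := z)) (Suc n)"
        "v \<in> complex_vector.span (insert y (e ` {..<n}))"
        using triangular_extend[OF B tri] by blast
      have "y \<in> complex_vector.span S"
        using RS[OF z] root_space_funpow[OF B x, of j] by (auto simp: y_def N_def[abs_def])
      then have "complex_vector.span (insert y (e ` {..<n})) \<subseteq> complex_vector.span S"
        using eS by (intro complex_vector.span_minimal complex_vector.subspace_span) auto
      with v(2) eS have "(e(n := v)) ` {..<Suc n} \<subseteq> complex_vector.span S"
        by (auto simp: lessThan_Suc)
      with v(1) have "P (Suc n)" unfolding P_def by blast
      with max show False by fastforce
    qed
  qed
  with tri show ?thesis by blast
qed

lemma alg_mult_le_card:
  assumes "bounded_clinear B" "triangular B e w n"
    and "root_space B z \<subseteq> complex_vector.span (e ` {..<n})"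
  shows "alg_mult B z \<le> card {i. i < n \<and> w i = z}"
proof -
  obtain S where "finite S" "card S \<le> card {i. i < n \<and> w i = z}"
    "root_space B z \<subseteq> complex_vector.span S"
    using root_space_triangular[OF assms(1,2), of z] assms(3) by (metis inf.absorb1)
  then show ?thesis
    unfolding alg_mult_def using complex_vector.dim_le_card order_trans by blast
qed

section \<open>Eigenvalues and the numerical range\<close>

text \<open>The unit vector \<open>f\<close> supplies a point of the numerical range, so the
  convention that \<open>infdist\<close> to the empty set is 0 does not interfere.\<close>

lemma infdist_numerical_range_le:
  assumes "norm f = 1" "cinner (B f) f = z"
  shows "infdist z (closure (numerical_range A)) \<le> cmod (cinner (B f - A f) f)"
proof -
  have "cinner (A f) f \<in> closure (numerical_range A)"
    by (intro subsetD[OF closure_subset]) (use assms(1) in \<open>auto simp: numerical_range_def\<close>)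
  from infdist_le[OF this, of z] show ?thesis
    by (simp add: cinner_diff_left assms(2) dist_norm)
qed

lemma finite_eigenvalue_sum_le:
  fixes A B :: "'a::chilbert_space \<Rightarrow> 'a"
  assumes p: "p \<ge> 1" and B: "bounded_clinear B" and K: "(\<lambda>x. B x - A x) \<in> schatten_class p"
    and Z: "finite Z" "\<And>z. z \<in> Z \<Longrightarrow> cfinite_dim (root_space B z)"
  shows "(\<Sum>z\<in>Z. real (alg_mult B z) * infdist z (closure (numerical_range A)) powr p)
    \<le> (\<Sum>n. singular_value (\<lambda>x. B x - A x) n powr p)"
proof -
  let ?K = "\<lambda>x. B x - A x"
  define d where "d z = infdist z (closure (numerical_range A)) powr p" for z
  have compact: "compact_operator ?K" and summ: "summable (\<lambda>n. singular_value ?K n powr p)"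
    using K by (auto simp: schatten_class_def)
  obtain E where "singular_basis ?K E" using singular_basis_exists[OF compact] by blast
  then interpret singular_basis ?K E .
  obtain e w n where tri: "triangular B e w n"
    and cover: "\<And>z. z \<in> Z \<Longrightarrow> root_space B z \<subseteq> complex_vector.span (e ` {..<n})"
    using triangular_basis_exists[OF B Z] by blast
  have e: "corthonormal e {..<n}" using tri by (simp add: triangular_def)
  have "(\<Sum>z\<in>Z. real (alg_mult B z) * d z) \<le> (\<Sum>z\<in>Z. real (card {i. i < n \<and> w i = z}) * d z)"
    using alg_mult_le_card[OF B tri cover] by (intro sum_mono mult_right_mono) (auto simp: d_def)
  \<comment> \<open>Multiplicities are spread over the indices of the Schur basis, so that each term
    can be compared with one diagonal entry.\<close>
  also have "\<dots> = (\<Sum>z\<in>Z. \<Sum>i\<in>{i \<in> {i. i < n \<and> w i \<in> Z}. w i = z}. d (w i))"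
  proof (rule sum.cong[OF refl])
    fix z assume "z \<in> Z"
    then have "{i \<in> {i. i < n \<and> w i \<in> Z}. w i = z} = {i. i < n \<and> w i = z}" by auto
    then show "real (card {i. i < n \<and> w i = z}) * d z
        = (\<Sum>i\<in>{i \<in> {i. i < n \<and> w i \<in> Z}. w i = z}. d (w i))"
      by simp
  qed
  also have "\<dots> = (\<Sum>i\<in>{i. i < n \<and> w i \<in> Z}. d (w i))"
    using Z(1) by (intro sum.group) auto
  also have "\<dots> \<le> (\<Sum>i<n. d (w i))"
    by (intro sum_mono2) (auto simp: d_def)
  also have "\<dots> \<le> (\<Sum>i<n. cmod (cinner (?K (e i)) (e i)) powr p)"
    unfolding d_def using p corthonormal_norm[OF e] triangular_diagonal[OF tri]
    by (intro sum_mono powr_mono2 infdist_numerical_range_le infdist_nonneg) auto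
  also have "\<dots> \<le> (\<Sum>n. singular_value ?K n powr p)"
    by (rule sum_diagonal_powr_le[OF e _ p summ]) simp
  finally show ?thesis by (simp add: d_def)
qed

theorem theorem2p1:
  fixes A B :: "'a::chilbert_space \<Rightarrow> 'a" and p :: real
  assumes "separable_space (euclidean :: 'a topology)"
    and "p \<ge> 1"
    and "bounded_clinear A" and "bounded_clinear B"
    and "(\<lambda>x. B x - A x) \<in> schatten_class p"
  shows "(\<lambda>z. real (alg_mult B z) * infdist z (closure (numerical_range A)) powr p)
           summable_on discrete_spectrum B
       \<and> (\<Sum>\<^sub>\<infinity>z \<in> discrete_spectrum B.
             real (alg_mult B z) * infdist z (closure (numerical_range A)) powr p)
           \<le> schatten_norm p (\<lambda>x. B x - A x) powr p"
proof -
  let ?f = "\<lambda>z. real (alg_mult B z) * infdist z (closure (numerical_range A)) powr p"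
  let ?S = "\<Sum>n. singular_value (\<lambda>x. B x - A x) n powr p"
  have le: "sum ?f Z \<le> ?S" if "finite Z" "Z \<subseteq> discrete_spectrum B" for Z
    using that by (intro finite_eigenvalue_sum_le assms) (auto simp: discrete_spectrum_def)
  \<comment> \<open>Nonnegativity makes the outer power undo the root in
    \<open>schatten_norm\<close>; the empty set of eigenvalues supplies it.\<close>
  have "?S \<ge> 0"
    using le[of "{}"] by simp
  then have S: "schatten_norm p (\<lambda>x. B x - A x) powr p = ?S"
    using assms(2) by (simp add: schatten_norm_def powr_powr)
  \<comment> \<open>The terms are nonnegative and \<open>?S\<close> bounds every finite partial sum,
    so convergence needs no ordering of the eigenvalues.\<close>
  have summ: "?f summable_on discrete_spectrum B"
    by (rule nonneg_bounded_partial_sums_imp_summable_on[where C = ?S])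
      (auto intro!: eventually_finite_subsets_at_top_weakI le)
  moreover have "infsum ?f (discrete_spectrum B) \<le> ?S"
    by (rule infsum_le_finite_sums[OF summ le])
  ultimately show ?thesis
    unfolding S ..
qed

end
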